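(* Let $X$ be a compact convex set. Then the intermediate function space $(A_s(X))^\sigma$ is determined by extreme points, i.e. for every $u\in (A_s(X))^\sigma$ and every $x\in X$, $$\inf u(\operatorname{ext}X)\le u(x)\le \sup u(\operatorname{ext} X).$$
   Context: A compact convex set is a compact convex subset of a (Hausdorff) locally convex real topological vector space; $\operatorname{ext}X$ is the set of its extreme points. $A_l(X)$ is the set of all real-valued lower semicontinuous affine functions on $X$ (they are bounded) and $A_s(X)=A_l(X)-A_l(X)$. For a family $F$ of bounded functions on $X$, $F^\sigma$ denotes the smallest family of functions on $X$ that contains $F$ and is closed with respect to taking limits of pointwise converging bounded sequences. An intermediate function space is a norm-closed linear subspace of the space of bounded affine functions on $X$ (with supremum norm) containing all continuous affine functions. *)

theory Defs
  imports "HOL-Analysis.Analysis"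
begin

text \<open>
  Hausdorff locally convex real topological vector spaces. The class axioms cannot mention
  the overloaded constant \<open>convex\<close>, so convexity of the basic neighbourhoods of \<open>0\<close> is spelled
  out; see \<open>convex_nhd_0\<close> below for the usual form.
\<close>

class locally_convex_space = real_vector + topological_ab_group_add + t2_space +
  assumes tendsto_scaleR_Pair:
    "LIM p (nhds c \<times>\<^sub>F nhds x). fst p *\<^sub>R snd p :> nhds (c *\<^sub>R x)"
  and convex_nhd_0_unfolded:
    "open U \<Longrightarrow> 0 \<in> U \<Longrightarrow>
      \<exists>V. open V \<and> 0 \<in> V \<and> V \<subseteq> U \<and>
        (\<forall>x\<in>V. \<forall>y\<in>V. \<forall>s\<ge>0. \<forall>t\<ge>0. s + t = 1 \<longrightarrow> s *\<^sub>R x + t *\<^sub>R y \<in> V)"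

lemma convex_nhd_0:
  fixes U :: "'a::locally_convex_space set"
  assumes "open U" "0 \<in> U"
  shows "\<exists>V. open V \<and> 0 \<in> V \<and> V \<subseteq> U \<and> convex V"
  using convex_nhd_0_unfolded[OF assms] unfolding convex_def by blast

instance real_normed_vector \<subseteq> locally_convex_space
proof
  fix c :: real and x :: 'a
  show "LIM p (nhds c \<times>\<^sub>F nhds x). fst p *\<^sub>R snd p :> nhds (c *\<^sub>R x)"
    by (intro tendsto_scaleR filterlim_fst filterlim_snd)
next
  fix U :: "'a set"
  assume "open U" "0 \<in> U"
  then obtain e where e: "e > 0" "ball 0 e \<subseteq> U"
    using open_contains_ball by blast
  then show "\<exists>V. open V \<and> 0 \<in> V \<and> V \<subseteq> U \<and>
      (\<forall>x\<in>V. \<forall>y\<in>V. \<forall>s\<ge>0. \<forall>t\<ge>0. s + t = 1 \<longrightarrow> s *\<^sub>R x + t *\<^sub>R y \<in> V)"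
    using convex_ball[of "0::'a" e] unfolding convex_def
    by (intro exI[of _ "ball 0 e"]) auto
qed

text \<open>
  Functions on \<open>X\<close> are modelled by total functions whose values outside \<open>X\<close> are irrelevant.
  For compact convex \<open>X\<close> the families \<open>A_l X\<close>, \<open>A_s X\<close> and \<open>sigma_closure X (A_s X)\<close> are
  invariant under changing their members outside \<open>X\<close>.
\<close>

definition affine_fun_on :: "'a::real_vector set \<Rightarrow> ('a \<Rightarrow> real) \<Rightarrow> bool" where
  "affine_fun_on X f \<longleftrightarrow>
    (\<forall>x\<in>X. \<forall>y\<in>X. \<forall>s\<ge>0. \<forall>t\<ge>0. s + t = 1 \<longrightarrow> f (s *\<^sub>R x + t *\<^sub>R y) = s * f x + t * f y)"

definition lower_semicontinuous_on :: "'a::topological_space set \<Rightarrow> ('a \<Rightarrow> real) \<Rightarrow> bool" where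
  "lower_semicontinuous_on X f \<longleftrightarrow> (\<forall>a. openin (top_of_set X) {x \<in> X. a < f x})"

definition A_l :: "'a::locally_convex_space set \<Rightarrow> ('a \<Rightarrow> real) set" where
  "A_l X = {f. affine_fun_on X f \<and> lower_semicontinuous_on X f}"

definition A_s :: "'a::locally_convex_space set \<Rightarrow> ('a \<Rightarrow> real) set" where
  "A_s X = {\<lambda>x. f x - g x | f g. f \<in> A_l X \<and> g \<in> A_l X}"

text \<open>
  In \<open>limit\<close>, boundedness of the sequence is in the supremum norm on \<open>X\<close>, i.e. the bound is
  uniform in the index and in the point.
\<close>

inductive_set sigma_closure :: "'a set \<Rightarrow> ('a \<Rightarrow> real) set \<Rightarrow> ('a \<Rightarrow> real) set"
  for X :: "'a set" and F :: "('a \<Rightarrow> real) set" where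
  base: "f \<in> F \<Longrightarrow> f \<in> sigma_closure X F"
| limit: "\<lbrakk>\<And>n::nat. f n \<in> sigma_closure X F;
           \<exists>C. \<forall>n. \<forall>x\<in>X. \<bar>f n x\<bar> \<le> C;
           \<And>x. x \<in> X \<Longrightarrow> (\<lambda>n. f n x) \<longlonglongrightarrow> g x\<rbrakk> \<Longrightarrow> g \<in> sigma_closure X F"

text \<open>
  The last clause is norm-closedness: a bounded function that can be approximated by members
  of \<open>H\<close> arbitrarily well, uniformly on \<open>X\<close>, belongs to \<open>H\<close>. It is stated without assuming that
  the limit is bounded or affine, since both are inherited from the approximants.
  That \<open>H\<close> contains \<open>0\<close> follows from the clause on continuous affine functions.
\<close>

definition intermediate_function_space ::
    "'a::locally_convex_space set \<Rightarrow> ('a \<Rightarrow> real) set \<Rightarrow> bool" where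
  "intermediate_function_space X H \<longleftrightarrow>
    (\<forall>f\<in>H. affine_fun_on X f \<and> bounded (f ` X)) \<and>
    (\<forall>f. affine_fun_on X f \<and> continuous_on X f \<longrightarrow> f \<in> H) \<and>
    (\<forall>f\<in>H. \<forall>g\<in>H. (\<lambda>x. f x + g x) \<in> H) \<and>
    (\<forall>c. \<forall>f\<in>H. (\<lambda>x. c * f x) \<in> H) \<and>
    (\<forall>f. (\<forall>e>0. \<exists>g\<in>H. \<forall>x\<in>X. \<bar>f x - g x\<bar> \<le> e) \<longrightarrow> f \<in> H)"

text \<open>
  The infimum and supremum are those of the reals, which are unspecified on unbounded and on
  empty sets. For compact convex \<open>X\<close> and bounded \<open>u\<close> this is harmless: if \<open>x \<in> X\<close> then \<open>X\<close> has an
  extreme point by the Krein--Milman theorem.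
\<close>

definition determined_by_extreme_points ::
    "'a::locally_convex_space set \<Rightarrow> ('a \<Rightarrow> real) set \<Rightarrow> bool" where
  "determined_by_extreme_points X H \<longleftrightarrow>
    (\<forall>u\<in>H. \<forall>x\<in>X.
      Inf (u ` {e. e extreme_point_of X}) \<le> u x \<and>
      u x \<le> Sup (u ` {e. e extreme_point_of X}))"

end

theory Submission
  imports Defs "HOL-Probability.Distribution_Functions"
begin

text \<open>
  Fix \<open>x\<close>. A function \<open>u\<close> in the \<open>\<sigma>\<close>-closure depends on countably many semicontinuous affine
  functions \<open>f\<close>. Truncated epigraphs of these, together with the negatives of continuous affine
  minorants \<open>h \<le> f\<close> that nearly touch \<open>f\<close> at \<open>x\<close>, give a compact convex subset \<open>Z\<close> of the Hilbert
  cube, on which Choquet's theorem provides a probability measure carried by the extreme points of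
  \<open>Z\<close> with barycentre \<open>(f x)\<^sub>f\<close>. Every extreme point of \<open>Z\<close> lifts to an extreme point \<open>e\<close> of the
  possibly nonmetrizable \<open>X\<close>, and each of its coordinates is \<open>f e\<close> or lies on the artificial
  upper face of the truncated epigraph; the minorants show that the latter has measure \<open>0\<close>. Hence
  \<open>f x\<close> is the mean of \<open>f e\<close> for random \<open>e\<close>, and dominated convergence carries this over to \<open>u\<close>.

  The Hilbert cube is replaced by \<open>{0..1}\<close> via Schoenberg's curve, so that the measure can be built
  from a distribution function on the line.
\<close>

subsection \<open>The Hahn--Banach theorem\<close>

text \<open>The obstacle is that \<open>ext X\<close> need not be measurable when \<open>X\<close>
  is not metrizable, so a representing measure on \<open>X\<close> cannot simply be restricted to
  it. The joint values of countably many functions form a metrizable set, on which a continuous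
  strictly convex function exists and Choquet's construction works. Since the joint graph of lower
  semicontinuous functions need not be compact, while the part of the epigraph below a constant is,
  epigraphs are used, at the price of the upper face. That face is excluded by a Markov estimate: up
  to scaling, the coordinates of \<open>f\<close> and of \<open>-h\<close> add up to a nonnegative
  function that dominates the excess of the first coordinate over \<open>f\<close> and has the small
  mean \<open>f x - h x\<close>. An extreme point of the coded set has a whole fibre in
  \<open>X\<close>; this fibre is a closed extremal set, so the Krein--Milman argument finds a point
  of \<open>ext X\<close> in it. The choice of this point need not be measurable. Only the functions
  in question are integrated along it, and these coincide almost everywhere with continuous
  coordinates.\<close>

definition sublinear :: "('a::real_vector \<Rightarrow> real) \<Rightarrow> bool" where
  "sublinear p \<longleftrightarrow> (\<forall>x y. p (x + y) \<le> p x + p y) \<and> (\<forall>c>0. \<forall>x. p (c *\<^sub>R x) \<le> c * p x)"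

lemma sublinearI:
  assumes "\<And>x y. p (x + y) \<le> p x + p y" "\<And>c x. c > 0 \<Longrightarrow> p (c *\<^sub>R x) \<le> c * p x"
  shows "sublinear p"
  using assms by (simp add: sublinear_def)

lemma sublinear_add: "sublinear p \<Longrightarrow> p (x + y) \<le> p x + p y"
  by (simp add: sublinear_def)

lemma sublinear_0:
  assumes "sublinear p" shows "p 0 = 0"
proof -
  have "p (c *\<^sub>R 0) \<le> c * p 0" if "c > 0" for c
    using assms that unfolding sublinear_def by blast
  from this[of 2] this[of "1/2"] show ?thesis by simp
qed

lemma sublinear_scaleR:
  assumes "sublinear p" "c \<ge> 0" shows "p (c *\<^sub>R x) = c * p x"
proof (cases "c = 0")
  case False
  then have c: "c > 0" using assms by simp
  have "p (c *\<^sub>R x) \<le> c * p x" using assms c unfolding sublinear_def by blast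
  moreover have "p (inverse c *\<^sub>R (c *\<^sub>R x)) \<le> inverse c * p (c *\<^sub>R x)"
    using assms c unfolding sublinear_def by (metis positive_imp_inverse_positive)
  ultimately show ?thesis using c by (simp add: field_simps)
qed (simp add: sublinear_0 assms)

lemma sublinear_minus_le: "sublinear p \<Longrightarrow> - p (- x) \<le> p x"
  using sublinear_add[of p x "- x"] sublinear_0[of p] by simp

text \<open>The infimum \<open>q\<close> below is the largest sublinear minorant of \<open>p\<close>
  whose value at \<open>- y\<close> is at most \<open>- p y\<close>. It takes the place of
  one-dimensional extensions in the Hahn--Banach theorem: it prescribes the value at a point, and it
  shows that minimality forces linearity.\<close>

lemma sublinear_shift:
  assumes p: "sublinear p"
  obtains q where "sublinear q" "\<And>x. q x \<le> p x" "q (- y) \<le> - p y"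
proof -
  define q where "q x = (INF t\<in>{0..}. p (x + t *\<^sub>R y) - t * p y)" for x
  have lb: "- p (- x) \<le> p (x + t *\<^sub>R y) - t * p y" if "t \<ge> 0" for x t
    using sublinear_add[OF p, of "x + t *\<^sub>R y" "- x"] sublinear_scaleR[OF p that, of y] by simp
  have bdd: "bdd_below ((\<lambda>t. p (x + t *\<^sub>R y) - t * p y) ` {0..})" for x
    using lb by (intro bdd_belowI2[where m = "- p (- x)"]) auto
  have le: "q x \<le> p (x + t *\<^sub>R y) - t * p y" if "t \<ge> 0" for x t
    unfolding q_def using that by (intro cINF_lower bdd) auto
  have ge: "m \<le> q x" if "\<And>t. t \<ge> 0 \<Longrightarrow> m \<le> p (x + t *\<^sub>R y) - t * p y" for m x
    unfolding q_def using that by (intro cINF_greatest) auto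
  show ?thesis
  proof
    show "sublinear q"
    proof (rule sublinearI)
      fix u v
      have "q (u + v) - (p (v + t *\<^sub>R y) - t * p y) \<le> p (u + s *\<^sub>R y) - s * p y"
        if "s \<ge> 0" "t \<ge> 0" for s t
        using le[of "s + t" "u + v"] sublinear_add[OF p, of "u + s *\<^sub>R y" "v + t *\<^sub>R y"] that
        by (simp add: algebra_simps)
      then have "q (u + v) - (p (v + t *\<^sub>R y) - t * p y) \<le> q u" if "t \<ge> 0" for t
        using ge that by blast
      then have "q (u + v) - q u \<le> q v"
        by (intro ge) (simp add: algebra_simps)
      then show "q (u + v) \<le> q u + q v" by simp
    next
      fix c :: real and x assume c: "c > 0"
      have "q (c *\<^sub>R x) / c \<le> q x"
      proof (rule ge)
        fix t :: real assume t: "t \<ge> 0"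
        have "q (c *\<^sub>R x) \<le> p (c *\<^sub>R (x + t *\<^sub>R y)) - c * t * p y"
          using le[of "c * t" "c *\<^sub>R x"] c t by (simp add: algebra_simps)
        also have "\<dots> = c * (p (x + t *\<^sub>R y) - t * p y)"
          using sublinear_scaleR[OF p, of c "x + t *\<^sub>R y"] c by (simp only: right_diff_distrib mult.assoc less_imp_le)
        finally show "q (c *\<^sub>R x) / c \<le> p (x + t *\<^sub>R y) - t * p y"
          using c by (simp add: field_simps)
      qed
      then show "q (c *\<^sub>R x) \<le> c * q x" using c by (simp add: field_simps)
    qed
    show "q x \<le> p x" for x using le[of 0 x] by simp
    show "q (- y) \<le> - p y" using le[of 1 "- y"] sublinear_0[OF p] by simp
  qed
qed

text \<open>Subadditivity survives the infimum because the family is a chain: given \<open>q\<close>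
  at \<open>x\<close> and \<open>r\<close> at \<open>y\<close>, the smaller of the two serves both
  points. The common bound \<open>p\<close> keeps all values above \<open>- p (- x)\<close>.\<close>

lemma sublinear_Inf_chain:
  assumes ne: "C \<noteq> {}" and sub: "\<And>q. q \<in> C \<Longrightarrow> sublinear q \<and> q \<le> p"
    and chain: "\<And>q r. q \<in> C \<Longrightarrow> r \<in> C \<Longrightarrow> q \<le> r \<or> r \<le> q"
  shows "sublinear (\<lambda>x. INF q\<in>C. q x)" "\<And>q. q \<in> C \<Longrightarrow> (\<lambda>x. INF q\<in>C. q x) \<le> q"
proof -
  have "- p (- x) \<le> q x" if "q \<in> C" for q x
    using sub[OF that] sublinear_minus_le[of q x] le_funD[of q p "- x"] by linarith
  then have bdd: "bdd_below ((\<lambda>q. q x) ` C)" for x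
    by (intro bdd_belowI2)
  show low: "(\<lambda>x. INF q\<in>C. q x) \<le> q" if "q \<in> C" for q
    by (auto intro!: le_funI cINF_lower bdd that)
  show "sublinear (\<lambda>x. INF q\<in>C. q x)"
  proof (rule sublinearI)
    fix x y
    have *: "(INF q\<in>C. q (x + y)) \<le> q x + r y" if qr: "q \<in> C" "r \<in> C" for q r
    proof -
      obtain s where s: "s \<in> C" "s \<le> q" "s \<le> r" using chain[OF qr] qr by blast
      have "(INF q\<in>C. q (x + y)) \<le> s (x + y)" by (intro cINF_lower bdd s)
      also have "\<dots> \<le> s x + s y" using sub[OF s(1)] sublinear_add by blast
      also have "\<dots> \<le> q x + r y" using s by (intro add_mono) (auto simp: le_fun_def)
      finally show ?thesis .
    qed
    have "(INF q\<in>C. q (x + y)) - r y \<le> (INF q\<in>C. q x)" if "r \<in> C" for r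
      using *[OF _ that] by (intro cINF_greatest ne) (simp add: algebra_simps)
    then have "(INF q\<in>C. q (x + y)) - (INF q\<in>C. q x) \<le> (INF q\<in>C. q y)"
      by (intro cINF_greatest ne) (simp add: algebra_simps)
    then show "(INF q\<in>C. q (x + y)) \<le> (INF q\<in>C. q x) + (INF q\<in>C. q y)" by simp
  next
    fix c :: real and x assume c: "c > 0"
    have "(INF q\<in>C. q (c *\<^sub>R x)) / c \<le> (INF q\<in>C. q x)"
    proof (intro cINF_greatest ne)
      fix q assume q: "q \<in> C"
      have "(INF q\<in>C. q (c *\<^sub>R x)) \<le> q (c *\<^sub>R x)" by (intro cINF_lower bdd q)
      also have "\<dots> = c * q x" using sub[OF q] sublinear_scaleR[of q c x] c by simp
      finally show "(INF q\<in>C. q (c *\<^sub>R x)) / c \<le> q x" using c by (simp add: field_simps)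
    qed
    then show "(INF q\<in>C. q (c *\<^sub>R x)) \<le> c * (INF q\<in>C. q x)" using c by (simp add: field_simps)
  qed
qed

lemma minimal_sublinear:
  assumes p: "sublinear p"
  obtains q where "sublinear q" "q \<le> p" "\<And>r. sublinear r \<Longrightarrow> r \<le> q \<Longrightarrow> r = q"
proof -
  let ?A = "{q. sublinear q \<and> q \<le> p}" and ?P = "\<lambda>q r. r \<le> (q :: 'a \<Rightarrow> real)"
  have "\<exists>m\<in>?A. \<forall>a\<in>?A. a \<le> m \<longrightarrow> a = m"
  proof (rule predicate_Zorn)
    show "partial_order_on ?A (relation_of ?P ?A)"
      by (rule partial_order_on_relation_ofI) auto
    fix C assume "C \<in> Chains (relation_of ?P ?A)"
    then have C: "\<And>q. q \<in> C \<Longrightarrow> sublinear q \<and> q \<le> p"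
        "\<And>q r. q \<in> C \<Longrightarrow> r \<in> C \<Longrightarrow> q \<le> r \<or> r \<le> q"
      by (auto simp: Chains_def relation_of_def)
    show "\<exists>u\<in>?A. \<forall>a\<in>C. u \<le> a"
    proof (cases "C = {}")
      case True then show ?thesis using p by auto
    next
      case False
      note inf = sublinear_Inf_chain[OF False C]
      moreover have "(\<lambda>x. INF q\<in>C. q x) \<le> p" using inf(2) C(1) False by (meson all_not_in_conv order_trans)
      ultimately show ?thesis by (intro bexI[of _ "\<lambda>x. INF q\<in>C. q x"]) auto
    qed
  qed
  then show ?thesis using that by (auto intro: order_trans)
qed

text \<open>A minimal sublinear \<open>l\<close> is linear: shifting it at \<open>y\<close> gives a
  smaller one, which by minimality is \<open>l\<close> itself, so \<open>l (- y) = - l y\<close>.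
  The minimal element is taken below \<open>p\<close> shifted at \<open>x0\<close>, which pins the
  value at \<open>x0\<close>, as passing to a minorant only lowers the value at
  \<open>- x0\<close>.\<close>

theorem hahn_banach_sublinear:
  fixes p :: "'a::real_vector \<Rightarrow> real"
  assumes p: "sublinear p"
  obtains l where "linear l" "\<And>x. l x \<le> p x" "l x0 = p x0"
proof -
  obtain p' where p': "sublinear p'" "\<And>x. p' x \<le> p x" "p' (- x0) \<le> - p x0"
    using sublinear_shift[OF p] by blast
  obtain l where l: "sublinear l" "l \<le> p'" and min: "\<And>r. sublinear r \<Longrightarrow> r \<le> l \<Longrightarrow> r = l"
    using minimal_sublinear[OF p'(1)] by blast
  have neg: "l (- y) = - l y" for y
  proof -
    obtain q where q: "sublinear q" "\<And>x. q x \<le> l x" "q (- y) \<le> - l y"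
      using sublinear_shift[OF l(1)] by blast
    then have "q = l" by (intro min le_funI)
    then show ?thesis using q(3) sublinear_minus_le[OF l(1), of y] by simp
  qed
  have "linear l"
  proof (rule linearI)
    show "l (x + y) = l x + l y" for x y
      using sublinear_add[OF l(1), of x y] sublinear_add[OF l(1), of "- x" "- y"] neg[of "x + y"]
      by (simp add: neg)
    show "l (c *\<^sub>R x) = c *\<^sub>R l x" for c x
    proof (cases "c \<ge> 0")
      case True then show ?thesis using sublinear_scaleR[OF l(1)] by simp
    next
      case False
      then have "l ((- c) *\<^sub>R x) = - c * l x" by (intro sublinear_scaleR l) auto
      then show ?thesis using neg[of "c *\<^sub>R x"] by simp
    qed
  qed
  moreover have le: "l x \<le> p x" for x using l(2) p'(2) by (meson le_funD order_trans)
  moreover have "l x0 = p x0"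
    using le[of x0] le_funD[OF l(2), of "- x0"] p'(3) neg[of x0] by linarith
  ultimately show ?thesis using that by blast
qed

text \<open>The gauge of \<open>W\<close> is sublinear, at most 1 on \<open>W\<close>, and at least
  1 at \<open>y\<close>: if \<open>inverse t *\<^sub>R y\<close> lay in \<open>W\<close> for some
  \<open>t < 1\<close>, so would \<open>y\<close>, because \<open>0 \<in> W\<close>. The functional
  is chosen to touch the gauge at \<open>y\<close>.\<close>

lemma hahn_banach_convex:
  fixes W :: "'a::real_vector set"
  assumes conv: "convex W" and absorbing: "\<And>x. \<exists>t>0. t *\<^sub>R x \<in> W" and "0 \<in> W" "y \<notin> W"
  obtains l where "linear l" "\<And>w. w \<in> W \<Longrightarrow> l w \<le> (1::real)" "l y \<ge> 1"
proof -
  define S where "S x = {t. t > 0 \<and> inverse t *\<^sub>R x \<in> W}" for x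
  define p where "p x = Inf (S x)" for x
  have ne: "S x \<noteq> {}" for x
  proof -
    obtain t where "t > 0" "t *\<^sub>R x \<in> W" using absorbing by blast
    then have "inverse t \<in> S x" by (simp add: S_def)
    then show ?thesis by blast
  qed
  have bdd: "bdd_below (S x)" for x by (intro bdd_belowI[of _ 0]) (auto simp: S_def)
  have low: "p x \<le> t" if "t \<in> S x" for t x unfolding p_def using that bdd by (rule cInf_lower)
  have "sublinear p"
  proof (rule sublinearI)
    fix u v
    have *: "s + t \<in> S (u + v)" if "s \<in> S u" "t \<in> S v" for s t
    proof -
      have "(s / (s + t)) *\<^sub>R (inverse s *\<^sub>R u) + (t / (s + t)) *\<^sub>R (inverse t *\<^sub>R v) \<in> W"
        using that by (intro convexD[OF conv]) (simp_all add: S_def add_divide_distrib[symmetric])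
      moreover have "(s / (s + t)) *\<^sub>R (inverse s *\<^sub>R u) + (t / (s + t)) *\<^sub>R (inverse t *\<^sub>R v)
          = inverse (s + t) *\<^sub>R (u + v)"
        using that by (simp add: S_def scaleR_add_right divide_inverse mult.commute mult.assoc[symmetric])
      ultimately show ?thesis using that by (simp add: S_def)
    qed
    have "p (u + v) - t \<le> p u" if "t \<in> S v" for t
      unfolding p_def[of u] using low[OF *[OF _ that]] by (intro cInf_greatest ne) (simp add: algebra_simps)
    then have "p (u + v) - p u \<le> p v"
      unfolding p_def[of v] by (intro cInf_greatest ne) (simp add: algebra_simps)
    then show "p (u + v) \<le> p u + p v" by simp
  next
    fix c :: real and x assume c: "c > 0"
    have "p (c *\<^sub>R x) / c \<le> p x"
      unfolding p_def[of x]
    proof (intro cInf_greatest ne)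
      fix t assume "t \<in> S x"
      then have "c * t \<in> S (c *\<^sub>R x)" using c by (simp add: S_def mult.commute mult.assoc[symmetric])
      then show "p (c *\<^sub>R x) / c \<le> t" using low c by (simp add: field_simps)
    qed
    then show "p (c *\<^sub>R x) \<le> c * p x" using c by (simp add: field_simps)
  qed
  then obtain l where l: "linear l" "\<And>x. l x \<le> p x" "l y = p y"
    using hahn_banach_sublinear by blast
  have "p w \<le> 1" if "w \<in> W" for w using that by (intro low) (simp add: S_def)
  then have "l w \<le> 1" if "w \<in> W" for w using l(2) that by (meson order_trans)
  moreover have "p y \<ge> 1"
    unfolding p_def
  proof (intro cInf_greatest ne)
    fix t assume t: "t \<in> S y"
    show "1 \<le> t"
    proof (rule ccontr)
      assume "\<not> 1 \<le> t"
      then have "t *\<^sub>R (inverse t *\<^sub>R y) + (1 - t) *\<^sub>R 0 \<in> W"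
        using t \<open>0 \<in> W\<close> by (intro convexD[OF conv]) (auto simp: S_def)
      then show False using t \<open>y \<notin> W\<close> by (simp add: S_def)
    qed
  qed
  ultimately show ?thesis using l that by auto
qed

subsection \<open>Locally convex spaces\<close>

lemma tendsto_scaleR_lcs:
  fixes g :: "'b \<Rightarrow> 'a::locally_convex_space"
  assumes "(f \<longlongrightarrow> c) F" "(g \<longlongrightarrow> x) F"
  shows "((\<lambda>z. f z *\<^sub>R g z) \<longlongrightarrow> c *\<^sub>R x) F"
  using filterlim_compose[OF tendsto_scaleR_Pair filterlim_Pair[OF assms]] by simp

lemma eventually_scaleR_diff_in_lcs:
  fixes V :: "'a::locally_convex_space set"
  assumes "open V" "0 \<in> V"
  shows "\<forall>\<^sub>F y in nhds x. c *\<^sub>R (y - x) \<in> V"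
proof -
  have "((\<lambda>y. c *\<^sub>R (y - x)) \<longlongrightarrow> c *\<^sub>R (x - x)) (nhds x)"
    by (intro tendsto_scaleR_lcs tendsto_intros filterlim_ident)
  from topological_tendstoD[OF this \<open>open V\<close>] show ?thesis using \<open>0 \<in> V\<close> by simp
qed

lemma open_absorbing_lcs:
  fixes V :: "'a::locally_convex_space set"
  assumes "open V" "0 \<in> V"
  shows "\<exists>t>0. t *\<^sub>R x \<in> V"
proof -
  have "((\<lambda>t. t *\<^sub>R x) \<longlongrightarrow> 0 *\<^sub>R x) (at_right 0)"
    by (intro tendsto_scaleR_lcs tendsto_intros)
  then have "\<forall>\<^sub>F t in at_right 0. t *\<^sub>R x \<in> V"
    using assms by (intro topological_tendstoD) auto
  moreover have "\<forall>\<^sub>F t in at_right 0. 0 < (t::real)" by (rule eventually_at_right_less)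
  ultimately have "\<forall>\<^sub>F t in at_right 0. t > 0 \<and> t *\<^sub>R x \<in> V" by eventually_elim simp
  then show ?thesis using eventually_happens'[OF trivial_limit_at_right_real] by blast
qed

lemma linear_continuous_lcs:
  fixes l :: "'a::locally_convex_space \<Rightarrow> real"
  assumes l: "linear l" and V: "open V" "0 \<in> V" "\<And>v. v \<in> V \<Longrightarrow> l v \<le> 1"
  shows "continuous_on S l"
proof -
  have "(l \<longlongrightarrow> l x) (nhds x)" for x
  proof (rule tendstoI)
    fix e :: real assume e: "e > 0"
    \<comment> \<open>\<open>V\<close> need not be symmetric, so both signs are tested. The factor 2
      turns \<open>l v \<le> 1\<close> into the bound \<open>e / 2\<close> and hence into a strict
      inequality.\<close>
    have "\<forall>\<^sub>F y in nhds x. (2 / e) *\<^sub>R (y - x) \<in> V \<and> (- 2 / e) *\<^sub>R (y - x) \<in> V"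
      by (intro eventually_conj eventually_scaleR_diff_in_lcs V)
    then show "\<forall>\<^sub>F y in nhds x. dist (l y) (l x) < e"
    proof eventually_elim
      case (elim y)
      then have "(2 / e) * (l y - l x) \<le> 1" "(- 2 / e) * (l y - l x) \<le> 1"
        using V(3) by (simp_all only: linear_cmul[OF l, symmetric] linear_diff[OF l, symmetric] real_scaleR_def[symmetric])
      then have "2 * (l y - l x) \<le> e" "- 2 * (l y - l x) \<le> e" using e by (simp_all add: field_simps)
      then show ?case using e by (simp add: dist_real_def)
    qed
  qed
  then show ?thesis
    unfolding continuous_on_def using tendsto_mono[OF at_within_le_nhds] by blast
qed

lemma separate_points_lcs:
  fixes x y :: "'a::locally_convex_space"
  assumes "x \<noteq> y"
  obtains l :: "'a \<Rightarrow> real" where "linear l" "continuous_on UNIV l" "l x \<noteq> l y"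
proof -
  obtain U where "open U" "0 \<in> U" "y - x \<notin> U"
    using t1_space_class.t1_space[of 0 "y - x"] assms by auto
  then obtain V where V: "open V" "0 \<in> V" "y - x \<notin> V" "convex V"
    using convex_nhd_0[of U] by blast
  obtain l where "linear l" "\<And>v. v \<in> V \<Longrightarrow> l v \<le> (1::real)" "l (y - x) \<ge> 1"
    using hahn_banach_convex[OF V(4) open_absorbing_lcs[OF V(1,2)] V(2,3)] by blast
  then show ?thesis
    using that[of l] linear_continuous_lcs[of l V UNIV] V linear_diff[of l y x] by force
qed

subsection \<open>Extreme points\<close>

definition extremal_subset :: "'a::real_vector set \<Rightarrow> 'a set \<Rightarrow> bool" where
  "extremal_subset F X \<longleftrightarrow> F \<subseteq> X \<and>
    (\<forall>a\<in>X. \<forall>b\<in>X. \<forall>t. 0 < t \<longrightarrow> t < 1 \<longrightarrow> (1 - t) *\<^sub>R a + t *\<^sub>R b \<in> F \<longrightarrow> a \<in> F \<and> b \<in> F)"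

lemma extremal_singleton:
  assumes "extremal_subset {x} X" shows "x extreme_point_of X"
  using assms by (force simp: extremal_subset_def extreme_point_of_def in_segment)

text \<open>An average with positive weights reaches the upper bound \<open>m\<close> only if both
  values do.\<close>

lemma extremal_subset_argmax:
  fixes l :: "'a::real_vector \<Rightarrow> real"
  assumes F: "extremal_subset F X" and l: "linear l" and m: "\<And>y. y \<in> F \<Longrightarrow> l y \<le> m"
  shows "extremal_subset {y\<in>F. l y = m} X"
  unfolding extremal_subset_def
proof (intro conjI ballI allI impI)
  show "{y\<in>F. l y = m} \<subseteq> X" using F by (auto simp: extremal_subset_def)
  fix a b and t :: real
  assume ab: "a \<in> X" "b \<in> X" and t: "0 < t" "t < 1" and "(1 - t) *\<^sub>R a + t *\<^sub>R b \<in> {y\<in>F. l y = m}"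
  then have "a \<in> F" "b \<in> F" and eq: "(1 - t) * l a + t * l b = m"
    using F by (auto simp: extremal_subset_def linear_add[OF l] linear_cmul[OF l])
  then have *: "l a \<le> m" "l b \<le> m" using m by auto
  then have "(1 - t) * l a \<le> (1 - t) * m" "t * l b \<le> t * m"
    using t by (intro mult_left_mono; simp)+
  then have "(1 - t) * l a = (1 - t) * m" "t * l b = t * m"
    using eq left_diff_distrib[of 1 t m] by linarith+
  then show "a \<in> {y\<in>F. l y = m}" "b \<in> {y\<in>F. l y = m}" using t \<open>a \<in> F\<close> \<open>b \<in> F\<close> by auto
qed

text \<open>Zorn's lemma downwards. Compactness makes the intersection of a chain nonempty;
  everything else about intersections is left to \<open>Inter\<close>.\<close>

lemma compact_minimal_closed_subset:
  fixes X :: "'a::topological_space set"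
  assumes "compact X" and F: "P F" and P: "\<And>G. P G \<Longrightarrow> closed G \<and> G \<noteq> {} \<and> G \<subseteq> X"
    and Inter: "\<And>\<C>. \<C> \<noteq> {} \<Longrightarrow> (\<And>G. G \<in> \<C> \<Longrightarrow> P G) \<Longrightarrow> \<Inter>\<C> \<noteq> {} \<Longrightarrow> P (\<Inter>\<C>)"
  obtains G where "P G" "G \<subseteq> F" "\<And>H. P H \<Longrightarrow> H \<subseteq> G \<Longrightarrow> H = G"
proof -
  let ?A = "{G. P G \<and> G \<subseteq> F}" and ?P = "\<lambda>G H. H \<subseteq> G"
  have "\<exists>m\<in>?A. \<forall>a\<in>?A. a \<subseteq> m \<longrightarrow> a = m"
  proof (rule predicate_Zorn)
    show "partial_order_on ?A (relation_of ?P ?A)"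
      by (rule partial_order_on_relation_ofI) auto
    fix C assume "C \<in> Chains (relation_of ?P ?A)"
    then have C: "\<And>G. G \<in> C \<Longrightarrow> P G \<and> G \<subseteq> F"
        and chain: "\<And>G H. G \<in> C \<Longrightarrow> H \<in> C \<Longrightarrow> G \<subseteq> H \<or> H \<subseteq> G"
      by (auto simp: Chains_def relation_of_def)
    show "\<exists>u\<in>?A. \<forall>a\<in>C. u \<subseteq> a"
    proof (cases "C = {}")
      case True then show ?thesis using F by auto
    next
      case False
      have fin: "\<exists>G\<in>C. G \<subseteq> \<Inter>D" if "finite D" "D \<noteq> {}" "D \<subseteq> C" for D
        using that
      proof (induction rule: finite_ne_induct)
        case (insert H D)
        then obtain G where "G \<in> C" "G \<subseteq> \<Inter>D" by auto
        moreover have "G \<subseteq> H \<or> H \<subseteq> G" "H \<in> C" using chain \<open>G \<in> C\<close> insert by auto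
        ultimately show ?case by (metis Inter_insert le_inf_iff order_refl order_trans)
      qed auto
      have "X \<inter> \<Inter>C \<noteq> {}"
      proof (rule compact_imp_fip[OF \<open>compact X\<close>])
        show "closed G" if "G \<in> C" for G using C P that by blast
        fix D assume D: "finite D" "D \<subseteq> C"
        show "X \<inter> \<Inter>D \<noteq> {}"
        proof (cases "D = {}")
          case True then show ?thesis using P[OF F] by auto
        next
          case False
          then obtain G where "G \<in> C" "G \<subseteq> \<Inter>D" using fin D by blast
          then show ?thesis using P[of G] C[of G] by blast
        qed
      qed
      then have "P (\<Inter>C)" using C False by (intro Inter) auto
      then show ?thesis using C False by (intro bexI[of _ "\<Inter>C"]) auto
    qed
  qed
  then obtain m where "P m" "m \<subseteq> F" "\<forall>a. P a \<and> a \<subseteq> F \<longrightarrow> a \<subseteq> m \<longrightarrow> a = m" by auto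
  then show ?thesis using that by (meson order_trans)
qed

text \<open>The Krein--Milman argument inside a closed extremal set: a minimal closed extremal
  subset with two points would shrink to the set where a continuous linear functional separating
  them is maximal.\<close>

theorem extremal_contains_extreme_point:
  fixes X :: "'a::locally_convex_space set"
  assumes X: "compact X" and F: "closed F" "F \<noteq> {}" "extremal_subset F X"
  obtains e where "e \<in> F" "e extreme_point_of X"
proof -
  let ?P = "\<lambda>G. closed G \<and> G \<noteq> {} \<and> extremal_subset G X"
  obtain G where G: "?P G" "G \<subseteq> F" and min: "\<And>H. ?P H \<Longrightarrow> H \<subseteq> G \<Longrightarrow> H = G"
  proof (rule compact_minimal_closed_subset[OF X, of ?P F])
    show "?P F" using F by simp
    show "?P G \<Longrightarrow> closed G \<and> G \<noteq> {} \<and> G \<subseteq> X" for G by (simp add: extremal_subset_def)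
    show "?P (\<Inter>\<C>)" if "\<C> \<noteq> {}" "\<And>G. G \<in> \<C> \<Longrightarrow> ?P G" "\<Inter>\<C> \<noteq> {}" for \<C>
    proof (intro conjI closed_Inter)
      show "extremal_subset (\<Inter>\<C>) X"
        using that unfolding extremal_subset_def by (intro conjI ballI allI impI InterI) blast+
    qed (use that in auto)
  qed blast
  obtain e where e: "e \<in> G" using G by blast
  have "G = {e}"
  proof (rule ccontr)
    assume "G \<noteq> {e}"
    then obtain y where y: "y \<in> G" "y \<noteq> e" using e by blast
    obtain l where l: "linear l" "continuous_on UNIV l" "l y \<noteq> (l e :: real)"
      using separate_points_lcs[OF y(2)] by blast
    have GX: "G \<subseteq> X" using G(1) by (simp add: extremal_subset_def)
    then have "compact G" using compact_Int_closed[OF X, of G] G(1) by (simp add: inf.absorb2)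
    then obtain z where z: "z \<in> G" "\<And>w. w \<in> G \<Longrightarrow> l w \<le> l z"
      using continuous_attains_sup[of G l] e continuous_on_subset[OF l(2), of G] by auto
    have "closed (G \<inter> l -` {l z})"
      using G(1) l(2) by (intro closed_Int closed_vimage) auto
    moreover have "G \<inter> l -` {l z} = {w\<in>G. l w = l z}" by auto
    ultimately have "{w\<in>G. l w = l z} = G"
      using z extremal_subset_argmax[of G X l "l z"] G(1) l(1) by (intro min) auto
    then have "l y = l z" "l e = l z" using y e by blast+
    then show False using l(3) by simp
  qed
  then show ?thesis using that[of e] e G extremal_singleton by blast
qed

subsection \<open>Semicontinuous affine functions\<close>

lemma affine_fun_on_lincomb:
  assumes "affine_fun_on X f" "affine_fun_on X g"
  shows "affine_fun_on X (\<lambda>x. a * f x + b * g x + c)"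
  unfolding affine_fun_on_def
proof (intro ballI allI impI)
  fix x y and s t :: real
  assume "x \<in> X" "y \<in> X" "s \<ge> 0" "t \<ge> 0" and st: "s + t = 1"
  then have *: "f (s *\<^sub>R x + t *\<^sub>R y) = s * f x + t * f y" "g (s *\<^sub>R x + t *\<^sub>R y) = s * g x + t * g y"
    using assms by (simp_all add: affine_fun_on_def)
  have "c = s * c + t * c" using st by (simp add: distrib_right[symmetric])
  then show "a * f (s *\<^sub>R x + t *\<^sub>R y) + b * g (s *\<^sub>R x + t *\<^sub>R y) + c
      = s * (a * f x + b * g x + c) + t * (a * f y + b * g y + c)"
    unfolding * by (simp add: algebra_simps)
qed

lemma continuous_imp_lower_semicontinuous_on:
  assumes "continuous_on X f" shows "lower_semicontinuous_on X f"
  unfolding lower_semicontinuous_on_def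
proof
  fix a
  have "openin (top_of_set X) (X \<inter> f -` {a<..})" using assms by (intro continuous_openin_preimage_gen) auto
  then show "openin (top_of_set X) {x \<in> X. a < f x}" by (simp add: vimage_def Int_def)
qed

lemma lower_semicontinuous_on_add:
  assumes f: "lower_semicontinuous_on X f" and g: "lower_semicontinuous_on X g"
  shows "lower_semicontinuous_on X (\<lambda>x. f x + g x)"
  unfolding lower_semicontinuous_on_def
proof
  fix a
  have "{x \<in> X. a < f x + g x} = (\<Union>q. {x \<in> X. q < f x} \<inter> {x \<in> X. a - q < g x})"
  proof (intro equalityI subsetI)
    fix x assume x: "x \<in> {x \<in> X. a < f x + g x}"
    then obtain q where "a - g x < q" "q < f x" using dense[of "a - g x" "f x"] by auto
    then show "x \<in> (\<Union>q. {x \<in> X. q < f x} \<inter> {x \<in> X. a - q < g x})"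
      using x by (intro UN_I[of q]) auto
  qed auto
  moreover have "openin (top_of_set X) \<dots>"
    using f g unfolding lower_semicontinuous_on_def by (intro openin_Union) auto
  ultimately show "openin (top_of_set X) {x \<in> X. a < f x + g x}" by simp
qed

lemma lower_semicontinuous_on_scale:
  assumes f: "lower_semicontinuous_on X f" and "c \<ge> 0"
  shows "lower_semicontinuous_on X (\<lambda>x. c * f x + d)"
proof (cases "c = 0")
  case True then show ?thesis by (simp add: continuous_imp_lower_semicontinuous_on)
next
  case False
  then have "{x \<in> X. a < c * f x + d} = {x \<in> X. (a - d) / c < f x}" for a
    using \<open>c \<ge> 0\<close> by (auto simp: field_simps)
  then show ?thesis using f unfolding lower_semicontinuous_on_def by simp
qed

lemma A_l_add: "f \<in> A_l X \<Longrightarrow> g \<in> A_l X \<Longrightarrow> (\<lambda>x. f x + g x) \<in> A_l X"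
  using affine_fun_on_lincomb[of X f g 1 1 0] lower_semicontinuous_on_add[of X f g] by (simp add: A_l_def)

lemma A_l_scale: "f \<in> A_l X \<Longrightarrow> c \<ge> 0 \<Longrightarrow> (\<lambda>x. c * f x + d) \<in> A_l X"
  using affine_fun_on_lincomb[of X f f c 0 d] lower_semicontinuous_on_scale[of X f c d] by (simp add: A_l_def)

lemma A_l_continuous: "affine_fun_on X f \<Longrightarrow> continuous_on X f \<Longrightarrow> f \<in> A_l X"
  by (simp add: A_l_def continuous_imp_lower_semicontinuous_on)

lemma A_l_const: "(\<lambda>_. c) \<in> A_l X"
  by (rule A_l_continuous) (auto simp: affine_fun_on_def distrib_right[symmetric])

lemma closed_sublevel:
  assumes X: "closed X" and f: "lower_semicontinuous_on X f"
  shows "closed {x \<in> X. f x \<le> a}"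
proof -
  have "X - {x \<in> X. a < f x} = {x \<in> X. f x \<le> a}" by auto
  then have "closedin (top_of_set X) {x \<in> X. f x \<le> a}"
    using f unfolding lower_semicontinuous_on_def by (metis closedin_diff closedin_topspace topspace_euclidean_subtopology)
  then show ?thesis using X closedin_closed_eq by blast
qed


text \<open>Semicontinuity and compactness bound \<open>f\<close> from below. The upper bound rests
  on affinity: if \<open>f (x k) > 4 ^ k\<close>, a point of \<open>X\<close> in which every
  \<open>x k\<close> has weight \<open>1 / 2 ^ (k + 1)\<close> would have infinite value. Such a
  point is obtained from compactness rather than from convergence of a series.\<close>

lemma A_l_bounded:
  assumes X: "compact X" "convex X" and f: "f \<in> A_l X"
  shows "bounded (f ` X)"
proof (cases "X = {}")
  case False
  have cl: "closed X" using X(1) by (rule compact_imp_closed)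
  have aff: "affine_fun_on X f" and lsc: "lower_semicontinuous_on X f" using f by (auto simp: A_l_def)
  have "\<exists>m. \<forall>x\<in>X. m < f x"
  proof (rule ccontr)
    assume no: "\<not> (\<exists>m. \<forall>x\<in>X. m < f x)"
    have "X \<inter> (\<Inter>n::nat. {x\<in>X. f x \<le> - real n}) \<noteq> {}"
    proof (rule compact_imp_fip_image[OF X(1)])
      show "closed {x\<in>X. f x \<le> - real n}" for n by (rule closed_sublevel[OF cl lsc])
      fix I :: "nat set" assume "finite I"
      then obtain N where N: "\<And>n. n \<in> I \<Longrightarrow> n \<le> N" using finite_nat_set_iff_bounded_le by auto
      obtain x where "x \<in> X" "f x \<le> - real N" using no by (meson not_less)
      then have "x \<in> X \<inter> (\<Inter>n\<in>I. {x\<in>X. f x \<le> - real n})" using N by force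
      then show "X \<inter> (\<Inter>n\<in>I. {x\<in>X. f x \<le> - real n}) \<noteq> {}" by blast
    qed
    then obtain x where x: "\<And>n::nat. f x \<le> - real n" by auto
    obtain n :: nat where "real n > - f x" using reals_Archimedean2 by blast
    then show False using x[of n] by linarith
  qed
  then obtain m where m: "\<And>x. x \<in> X \<Longrightarrow> m < f x" by blast
  have "\<exists>M. \<forall>x\<in>X. f x \<le> M"
  proof (rule ccontr)
    assume "\<not> (\<exists>M. \<forall>x\<in>X. f x \<le> M)"
    then have "\<forall>n::nat. \<exists>x\<in>X. f x > 4 ^ n" by (meson not_less)
    then obtain x where x: "\<And>n. x n \<in> X" "\<And>n::nat. f (x n) > 4 ^ n" by metis
    text \<open>A point of \<open>Y n\<close> is \<open>\<Sum>k<n. x k / 2 ^ (k + 1)\<close> plus \<open>2 ^ - n\<close> times a point of \<open>X\<close>, so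
      that \<open>f\<close> is large there; these compact sets decrease.\<close>
    define s where "s n = (\<Sum>k<n. (1 / 2 ^ (k + 1)) *\<^sub>R x k)" for n :: nat
    define Y where "Y n = (\<lambda>y. s n + (1 / 2 ^ n) *\<^sub>R y) ` X" for n :: nat
    have Suc: "Y (Suc n) \<subseteq> Y n" for n
    proof
      fix z assume "z \<in> Y (Suc n)"
      then obtain y where y: "y \<in> X" "z = s (Suc n) + (1 / 2 ^ Suc n) *\<^sub>R y" by (auto simp: Y_def)
      have "z = s n + (1 / 2 ^ n) *\<^sub>R ((1/2) *\<^sub>R x n + (1/2) *\<^sub>R y)"
        by (simp add: y(2) s_def scaleR_add_right mult.commute)
      moreover have "(1/2) *\<^sub>R x n + (1/2) *\<^sub>R y \<in> X" using x(1) y(1) by (intro convexD[OF X(2)]) auto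
      ultimately show "z \<in> Y n" by (auto simp: Y_def)
    qed
    have dec: "Y n \<subseteq> Y k" if "k \<le> n" for k n
      using that by (induction rule: dec_induct) (use Suc in blast)+
    have YX: "Y n \<subseteq> X" for n using dec[of 0 n] by (auto simp: Y_def s_def)
    have low: "f z \<ge> real n / 2 - \<bar>m\<bar>" if zY: "z \<in> Y n" for z n
    proof -
      \<comment> \<open>Induction that peels off the last term: the tail \<open>y\<close> is
        replaced by the midpoint \<open>w\<close> of \<open>x n\<close> and \<open>y\<close>. The
        value \<open>4 ^ n\<close> with weight \<open>1 / 2 ^ (n + 1)\<close> contributes
        \<open>2 ^ n / 2\<close>.\<close>
      have val: "f (s n + (1 / 2 ^ n) *\<^sub>R y) \<ge> (\<Sum>k<n. 2 ^ k / 2) + (1 / 2 ^ n) * f y" if "y \<in> X" for n y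
        using that
      proof (induction n arbitrary: y)
        case 0 then show ?case by (simp add: s_def)
      next
        case (Suc n)
        define w where "w = (1/2) *\<^sub>R x n + (1/2) *\<^sub>R y"
        have w: "w \<in> X" unfolding w_def using x(1) Suc.prems by (intro convexD[OF X(2)]) auto
        have fw: "f w = (1/2) * f (x n) + (1/2) * f y"
          unfolding w_def using aff x(1) Suc.prems by (auto simp: affine_fun_on_def)
        have "s (Suc n) + (1 / 2 ^ Suc n) *\<^sub>R y = s n + (1 / 2 ^ n) *\<^sub>R w"
          by (simp add: w_def s_def scaleR_add_right mult.commute)
        then have "f (s (Suc n) + (1 / 2 ^ Suc n) *\<^sub>R y) \<ge> (\<Sum>k<n. 2 ^ k / 2) + (1 / 2 ^ n) * f w"
          using Suc.IH[OF w] by simp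
        moreover have "(1 / 2 ^ n) * f w = (1 / 2 ^ Suc n) * f (x n) + (1 / 2 ^ Suc n) * f y"
          by (simp add: fw field_simps)
        moreover have "(2 ^ n / 2 :: real) = (1 / 2 ^ Suc n) * 4 ^ n"
          using power_mult_distrib[of "2::real" 2 n] by simp
        moreover have "(1 / 2 ^ Suc n) * 4 ^ n \<le> (1 / 2 ^ Suc n) * f (x n)"
          using x(2)[of n] by (intro mult_left_mono) auto
        ultimately show ?case by (simp only: sum.lessThan_Suc)
      qed
      obtain y where y: "y \<in> X" "z = s n + (1 / 2 ^ n) *\<^sub>R y" using zY by (auto simp: Y_def)
      have "real n / 2 = (\<Sum>k<n. 1 / 2)" by simp
      also have "\<dots> \<le> (\<Sum>k<n. 2 ^ k / 2)" by (intro sum_mono divide_right_mono) auto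
      finally have "real n / 2 \<le> (\<Sum>k<n. 2 ^ k / 2)" .
      moreover have "(1 / 2 ^ n) * f y \<ge> - \<bar>m\<bar>"
      proof -
        have "(1 / 2 ^ n) * f y \<ge> (1 / 2 ^ n) * (- \<bar>m\<bar>)" using m[OF y(1)] by (intro mult_left_mono) auto
        moreover have "(1 / 2 ^ n) * \<bar>m\<bar> \<le> 1 * \<bar>m\<bar>" by (intro mult_right_mono) auto
        ultimately show ?thesis by simp
      qed
      ultimately show ?thesis using val[OF y(1), of n] unfolding y(2) by linarith
    qed
    have cont: "continuous_on X (\<lambda>y. s n + (1 / 2 ^ n) *\<^sub>R y)" for n
      unfolding continuous_on_def by (intro ballI tendsto_intros tendsto_scaleR_lcs tendsto_ident_at)
    have clY: "closed (Y n)" for n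
      unfolding Y_def using compact_continuous_image[OF cont X(1)] by (rule compact_imp_closed)
    have "X \<inter> (\<Inter>n. Y n) \<noteq> {}"
    proof (rule compact_imp_fip_image[OF X(1) clY])
      fix I :: "nat set" assume "finite I"
      then obtain N where "\<And>n. n \<in> I \<Longrightarrow> n \<le> N" using finite_nat_set_iff_bounded_le by auto
      then have "Y N \<subseteq> X \<inter> (\<Inter>n\<in>I. Y n)" using dec YX by blast
      moreover have "Y N \<noteq> {}" using \<open>X \<noteq> {}\<close> by (simp add: Y_def)
      ultimately show "X \<inter> (\<Inter>n\<in>I. Y n) \<noteq> {}" by blast
    qed
    then obtain z where "\<And>n. z \<in> Y n" by blast
    then have "real n \<le> 2 * (f z + \<bar>m\<bar>)" for n :: nat using low[of z n] by simp
    then show False using reals_Archimedean2 by (meson not_less)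
  qed
  then obtain M where "\<And>x. x \<in> X \<Longrightarrow> f x \<le> M" by blast
  then have "\<bar>f x\<bar> \<le> max \<bar>m\<bar> \<bar>M\<bar>" if "x \<in> X" for x using m[OF that] that by fastforce
  then show ?thesis by (auto intro!: boundedI)
qed simp

text \<open>Hahn--Banach separation of the point \<open>(x0, a)\<close> from the epigraph of
  \<open>f\<close> in the product with the real line. Lower semicontinuity keeps a neighbourhood of
  the point off the epigraph.\<close>

lemma A_l_continuous_minorant:
  fixes X :: "'a::locally_convex_space set"
  assumes "convex X" and f: "f \<in> A_l X" and x0: "x0 \<in> X" and a: "a < f x0"
  obtains h where "affine_fun_on X h" "continuous_on X h" "h x0 = a" "\<And>x. x \<in> X \<Longrightarrow> h x \<le> f x"
proof -
  have aff: "affine_fun_on X f" and lsc: "lower_semicontinuous_on X f" using f by (auto simp: A_l_def)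
  obtain b where b: "a < b" "b < f x0" using dense[OF a] by blast
  obtain U where U: "open U" "{x\<in>X. b < f x} = X \<inter> U"
    using lsc unfolding lower_semicontinuous_on_def openin_open by blast
  have "open ((\<lambda>v. x0 + v) -` U)"
    by (rule open_vimage[OF U(1)]) (auto simp: continuous_on_def intro!: tendsto_intros)
  then obtain V where V: "open V" "0 \<in> V" "V \<subseteq> (\<lambda>v. x0 + v) -` U" "convex V"
    using convex_nhd_0[of "(\<lambda>v. x0 + v) -` U"] U(2) x0 b by auto
  define E where "E = {(x, r). x \<in> X \<and> f x \<le> r}"
  \<comment> \<open>The epigraph is reflected and moved so that \<open>(x0, f x0)\<close> goes to 0,
    then fattened by \<open>V\<close> and an interval of radius \<open>b - a\<close>. The point
    \<open>(x0, a)\<close> goes to \<open>(0, f x0 - a)\<close>, and the gap between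
    \<open>a\<close> and \<open>b\<close> keeps it outside even after fattening.\<close>
  define W where "W = {(v - x + x0, s - r + f x0) | v s x r. v \<in> V \<and> \<bar>s\<bar> < b - a \<and> (x, r) \<in> E}"
  have conv: "convex W"
    unfolding convex_def
  proof (intro ballI allI impI)
    fix w w' and p q :: real assume w: "w \<in> W" "w' \<in> W" and pq: "0 \<le> p" "0 \<le> q" "p + q = 1"
    obtain v s x r v' s' x' r' where
      e: "w = (v - x + x0, s - r + f x0)" "v \<in> V" "\<bar>s\<bar> < b - a" "x \<in> X" "f x \<le> r"
         "w' = (v' - x' + x0, s' - r' + f x0)" "v' \<in> V" "\<bar>s'\<bar> < b - a" "x' \<in> X" "f x' \<le> r'"
      using w by (auto simp: W_def E_def)
    have "p *\<^sub>R v + q *\<^sub>R v' \<in> V" "p *\<^sub>R x + q *\<^sub>R x' \<in> X"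
      using e pq V(4) \<open>convex X\<close> by (auto intro: convexD)
    moreover have "\<bar>p * s + q * s'\<bar> < b - a"
      using convexD[OF convex_ball[of 0 "b - a"], of s s' p q] e pq by (simp add: dist_real_def)
    moreover have "f (p *\<^sub>R x + q *\<^sub>R x') \<le> p * r + q * r'"
      using aff e pq by (auto simp: affine_fun_on_def intro!: add_mono mult_left_mono)
    moreover have "p *\<^sub>R w + q *\<^sub>R w' = ((p *\<^sub>R v + q *\<^sub>R v') - (p *\<^sub>R x + q *\<^sub>R x') + x0,
       (p * s + q * s') - (p * r + q * r') + f x0)"
    proof -
      have "x0 = p *\<^sub>R x0 + q *\<^sub>R x0" "f x0 = p * f x0 + q * f x0"
        using pq by (simp_all add: scaleR_add_left[symmetric] distrib_right[symmetric])
      then show ?thesis unfolding e by (simp add: algebra_simps)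
    qed
    ultimately show "p *\<^sub>R w + q *\<^sub>R w' \<in> W" by (auto simp: W_def E_def)
  qed
  have VW: "(v, s) \<in> W" if "v \<in> V" "\<bar>s\<bar> < b - a" for v s
    unfolding W_def using that x0
    by (intro CollectI exI[of _ v] exI[of _ s] exI[of _ x0] exI[of _ "f x0"]) (simp add: E_def)
  have "\<exists>t>0. t *\<^sub>R z \<in> W" for z
  proof -
    obtain t where t: "t > 0" "t *\<^sub>R fst z \<in> V" using open_absorbing_lcs[OF V(1,2)] by blast
    obtain t' where t': "t' > 0" "\<bar>t' * snd z\<bar> < b - a"
      using open_absorbing_lcs[of "ball 0 (b - a)" "snd z"] b by (auto simp: dist_real_def)
    define u where "u = min t t'"
    have "u *\<^sub>R fst z = (u / t) *\<^sub>R (t *\<^sub>R fst z) + (1 - u / t) *\<^sub>R 0" using t by simp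
    also have "\<dots> \<in> V" using V t t' by (intro convexD) (auto simp: u_def)
    finally have "u *\<^sub>R fst z \<in> V" .
    moreover have "\<bar>u * snd z\<bar> < b - a"
      using t t' mult_right_mono[of u t' "\<bar>snd z\<bar>"] by (auto simp: u_def abs_mult)
    ultimately have "u *\<^sub>R z \<in> W" using VW[of "u *\<^sub>R fst z" "u * snd z"] by (cases z) auto
    then show ?thesis using t t' by (intro exI[of _ u]) (auto simp: u_def)
  qed
  moreover have "0 \<in> W" using VW[of 0 0] V b by (simp add: zero_prod_def)
  moreover have "(0, f x0 - a) \<notin> W"
  proof
    assume "(0, f x0 - a) \<in> W"
    then obtain v s x r where *: "v - x + x0 = 0" "s - r = - a" "v \<in> V" "\<bar>s\<bar> < b - a" "x \<in> X" "f x \<le> r"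
      by (auto simp: W_def E_def)
    then have "x = x0 + v" by (simp add: algebra_simps)
    then have "b < f x" using V(3) U(2) *(3,5) by blast
    then show False using * by linarith
  qed
  ultimately obtain l where l: "linear l" "\<And>w. w \<in> W \<Longrightarrow> l w \<le> (1::real)" "l (0, f x0 - a) \<ge> 1"
    using hahn_banach_convex[OF conv] by blast
  define l1 where "l1 v = l (v, 0)" for v
  define c where "c = l (0, 1)"
  have lin1: "linear l1"
    unfolding l1_def by (rule linear_compose[of "\<lambda>v. (v, 0)" l, unfolded o_def])
      (auto intro!: linearI l(1))
  have l_eq: "l (v, s) = l1 v + c * s" for v s
    using linear_add[OF l(1), of "(v, 0)" "s *\<^sub>R (0, 1)"] linear_cmul[OF l(1), of s "(0, 1)"]
    by (simp add: l1_def c_def)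
  \<comment> \<open>The separating hyperplane is not vertical, so it is the graph of an affine
    function.\<close>
  have "c * (f x0 - a) \<ge> 1" using l(3) by (simp add: l_eq linear_0[OF lin1])
  then have c: "c > 0" using a by (smt (verit) mult_nonpos_nonneg)
  have cont: "continuous_on X l1"
    using linear_continuous_lcs[OF lin1 V(1,2)] l(2)[OF VW[of _ 0]] b by (simp add: l_eq)
  have le: "l1 x0 + c * a \<le> l1 x + c * f x" if "x \<in> X" for x
  proof -
    have "(0 - x + x0, 0 - f x + f x0) \<in> W"
      unfolding W_def using that V b
      by (intro CollectI exI[of _ 0] exI[of _ "0::real"] exI[of _ x] exI[of _ "f x"]) (simp add: E_def)
    from l(2)[OF this] show ?thesis
      using \<open>c * (f x0 - a) \<ge> 1\<close> linear_diff[OF lin1, of x0 x] by (simp add: l_eq algebra_simps)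
  qed
  show ?thesis
  proof (rule that[of "\<lambda>x. a + (l1 x0 - l1 x) / c"])
    have "affine_fun_on X l1"
      using linear_add[OF lin1] linear_cmul[OF lin1] by (simp add: affine_fun_on_def)
    from affine_fun_on_lincomb[OF this this, of "- 1 / c" 0 "a + l1 x0 / c"]
    show "affine_fun_on X (\<lambda>x. a + (l1 x0 - l1 x) / c)" by (simp add: diff_divide_distrib algebra_simps)
    show "continuous_on X (\<lambda>x. a + (l1 x0 - l1 x) / c)"
      using c by (intro continuous_intros cont) auto
    show "a + (l1 x0 - l1 x) / c \<le> f x" if "x \<in> X" for x
      using le[OF that] c by (simp add: field_simps)
  qed simp
qed

subsection \<open>Closure under bounded pointwise limits\<close>

lemma sigma_closure_bounded:
  assumes "\<And>f. f \<in> F \<Longrightarrow> bounded (f ` X)" "f \<in> sigma_closure X F"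
  shows "bounded (f ` X)"
  using assms(2)
proof induction
  case (base f) then show ?case by (rule assms(1))
next
  case (limit f g)
  then obtain C where C: "\<And>n x. x \<in> X \<Longrightarrow> \<bar>f n x\<bar> \<le> C" by blast
  have "\<bar>g x\<bar> \<le> C" if "x \<in> X" for x
    using C[OF that] by (intro LIMSEQ_le_const2[OF tendsto_rabs[OF limit.hyps(3)[OF that]]]) auto
  then show ?case by (auto intro!: boundedI)
qed

lemma sigma_closure_mult:
  assumes F: "\<And>f. f \<in> F \<Longrightarrow> (\<lambda>x. c * f x) \<in> F" and f: "f \<in> sigma_closure X F"
  shows "(\<lambda>x. c * f x) \<in> sigma_closure X F"
  using f
proof induction
  case (base f) then show ?case by (intro sigma_closure.base F)
next
  case (limit f g)
  obtain C where C: "\<And>n x. x \<in> X \<Longrightarrow> \<bar>f n x\<bar> \<le> C" using limit by blast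
  show ?case
  proof (rule sigma_closure.limit)
    show "\<exists>D. \<forall>n. \<forall>x\<in>X. \<bar>c * f n x\<bar> \<le> D"
      using C by (intro exI[of _ "\<bar>c\<bar> * C"]) (auto simp: abs_mult intro!: mult_left_mono)
  qed (use limit in \<open>auto intro: tendsto_mult_left\<close>)
qed

text \<open>Two nested inductions: a member of \<open>F\<close> is added to the closure before an
  arbitrary member of the closure is. Both limit steps are instances of \<open>lim\<close>, in which
  the fixed summand contributes its own bound.\<close>

lemma sigma_closure_add:
  assumes F: "\<And>f g. f \<in> F \<Longrightarrow> g \<in> F \<Longrightarrow> (\<lambda>x. f x + g x) \<in> F"
    and bdd: "\<And>f. f \<in> F \<Longrightarrow> bounded (f ` X)"
    and f: "f \<in> sigma_closure X F" and g: "g \<in> sigma_closure X F"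
  shows "(\<lambda>x. f x + g x) \<in> sigma_closure X F"
proof -
  have lim: "(\<lambda>x. f' x + g x) \<in> sigma_closure X F"
    if f: "\<And>n. (\<lambda>x. f n x + g x) \<in> sigma_closure X F"
      and C: "\<exists>C. \<forall>n. \<forall>x\<in>X. \<bar>f n x\<bar> \<le> C"
      and conv: "\<And>x. x \<in> X \<Longrightarrow> (\<lambda>n. f n x) \<longlonglongrightarrow> f' x"
      and g: "g \<in> sigma_closure X F" for f :: "nat \<Rightarrow> 'a \<Rightarrow> real" and f' g
  proof (rule sigma_closure.limit[of "\<lambda>n x. f n x + g x"])
    obtain C where C: "\<And>n x. x \<in> X \<Longrightarrow> \<bar>f n x\<bar> \<le> C" using C by blast
    obtain D where D: "\<And>x. x \<in> X \<Longrightarrow> \<bar>g x\<bar> \<le> D"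
      using sigma_closure_bounded[OF bdd g] by (auto simp: bounded_iff)
    show "\<exists>E. \<forall>n. \<forall>x\<in>X. \<bar>f n x + g x\<bar> \<le> E"
      using C D by (intro exI[of _ "C + D"]) (meson abs_triangle_ineq add_mono order_trans)
  qed (use f conv in \<open>auto intro: tendsto_intros\<close>)
  have *: "(\<lambda>x. f x + g x) \<in> sigma_closure X F" if "f \<in> sigma_closure X F" "g \<in> F" for f g
    using that
  proof induction
    case (base f) then show ?case by (intro sigma_closure.base F)
  next
    case (limit f f') then show ?case using sigma_closure.base[of g F X] by (intro lim[of f g f']) auto
  qed
  show ?thesis
    using g
  proof induction
    case (base g) then show ?case using * f by blast
  next
    case (limit g g')
    then have "(\<lambda>x. g' x + f x) \<in> sigma_closure X F" using f by (intro lim[of g f g']) (auto simp: add.commute)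
    then show ?case by (simp add: add.commute)
  qed
qed

lemma sigma_closure_affine:
  assumes "convex X" and F: "\<And>f. f \<in> F \<Longrightarrow> affine_fun_on X f" and f: "f \<in> sigma_closure X F"
  shows "affine_fun_on X f"
  using f
proof induction
  case (base f) then show ?case by (rule F)
next
  case (limit f g)
  show ?case
    unfolding affine_fun_on_def
  proof (intro ballI allI impI)
    fix x y and s t :: real assume *: "x \<in> X" "y \<in> X" "0 \<le> s" "0 \<le> t" "s + t = 1"
    then have "(\<lambda>n. f n (s *\<^sub>R x + t *\<^sub>R y)) \<longlonglongrightarrow> g (s *\<^sub>R x + t *\<^sub>R y)"
      using \<open>convex X\<close> by (intro limit) (auto intro: convexD)
    moreover have "(\<lambda>n. s * f n x + t * f n y) \<longlonglongrightarrow> s * g x + t * g y"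
      using * by (intro tendsto_intros limit)
    moreover have "f n (s *\<^sub>R x + t *\<^sub>R y) = s * f n x + t * f n y" for n
      using limit.IH[of n] * by (simp add: affine_fun_on_def)
    ultimately show "g (s *\<^sub>R x + t *\<^sub>R y) = s * g x + t * g y"
      using LIMSEQ_unique by simp
  qed
qed

lemma sigma_closure_uniform_limit:
  assumes bdd: "\<And>f. f \<in> F \<Longrightarrow> bounded (f ` X)"
    and f: "\<And>e. e > 0 \<Longrightarrow> \<exists>g\<in>sigma_closure X F. \<forall>x\<in>X. \<bar>f x - g x\<bar> \<le> e"
  shows "f \<in> sigma_closure X F"
proof -
  have "\<exists>g\<in>sigma_closure X F. \<forall>x\<in>X. \<bar>f x - g x\<bar> \<le> inverse (Suc n)" for n :: nat
    by (rule f) simp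
  then obtain g where g: "\<And>n. g n \<in> sigma_closure X F"
      "\<And>n x. x \<in> X \<Longrightarrow> \<bar>f x - g n x\<bar> \<le> inverse (Suc n)"
    by metis
  show ?thesis
  proof (rule sigma_closure.limit[OF g(1)])
    obtain D where D: "\<And>x. x \<in> X \<Longrightarrow> \<bar>g 0 x\<bar> \<le> D"
      using sigma_closure_bounded[OF bdd g(1)[of 0]] by (auto simp: bounded_iff)
    \<comment> \<open>\<open>D\<close> bounds \<open>g 0\<close>; the distances of \<open>f\<close>
      from \<open>g 0\<close> and from \<open>g n\<close> cost at most 1 each.\<close>
    have "\<bar>g n x\<bar> \<le> D + 2" if "x \<in> X" for n x
    proof -
      have "inverse (real (Suc n)) \<le> 1" by (simp add: field_simps)
      then show ?thesis using D[OF that] g(2)[OF that, of n] g(2)[OF that, of 0] by simp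
    qed
    then show "\<exists>C. \<forall>n. \<forall>x\<in>X. \<bar>g n x\<bar> \<le> C" by blast
    fix x assume x: "x \<in> X"
    have "(\<lambda>n. g n x - f x) \<longlonglongrightarrow> 0"
      using g(2)[OF x] by (intro Lim_null_comparison[OF _ LIMSEQ_inverse_real_of_nat] always_eventually)
        (simp add: abs_minus_commute)
    then show "(\<lambda>n. g n x) \<longlonglongrightarrow> f x" by (rule LIM_zero_cancel)
  qed
qed

section \<open>Linear structure of \<open>A_s X\<close> and of its closure\<close>

lemma A_s_I: "f \<in> A_l X \<Longrightarrow> g \<in> A_l X \<Longrightarrow> u = (\<lambda>x. f x - g x) \<Longrightarrow> u \<in> A_s X"
  by (auto simp: A_s_def)

lemma A_s_add:
  assumes "f \<in> A_s X" "g \<in> A_s X" shows "(\<lambda>x. f x + g x) \<in> A_s X"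
proof -
  obtain f1 f2 g1 g2 where *: "f1 \<in> A_l X" "f2 \<in> A_l X" "g1 \<in> A_l X" "g2 \<in> A_l X"
      "f = (\<lambda>x. f1 x - f2 x)" "g = (\<lambda>x. g1 x - g2 x)"
    using assms by (auto simp: A_s_def)
  have "(\<lambda>x. f x + g x) = (\<lambda>x. (f1 x + g1 x) - (f2 x + g2 x))" by (simp add: * algebra_simps)
  then show ?thesis by (rule A_s_I[OF A_l_add[OF *(1,3)] A_l_add[OF *(2,4)]])
qed

lemma A_s_mult:
  assumes "f \<in> A_s X" shows "(\<lambda>x. c * f x) \<in> A_s X"
proof -
  obtain f1 f2 where *: "f1 \<in> A_l X" "f2 \<in> A_l X" "f = (\<lambda>x. f1 x - f2 x)"
    using assms by (auto simp: A_s_def)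
  show ?thesis
  proof (cases "c \<ge> 0")
    case True
    then have "(\<lambda>x. c * f1 x) \<in> A_l X" "(\<lambda>x. c * f2 x) \<in> A_l X"
      using A_l_scale[of _ X c 0] * by simp_all
    moreover have "(\<lambda>x. c * f x) = (\<lambda>x. c * f1 x - c * f2 x)" by (simp add: * algebra_simps)
    ultimately show ?thesis by (rule A_s_I)
  next
    case False
    then have "(\<lambda>x. - c * f2 x) \<in> A_l X" "(\<lambda>x. - c * f1 x) \<in> A_l X"
      using A_l_scale[of _ X "- c" 0] * by simp_all
    moreover have "(\<lambda>x. c * f x) = (\<lambda>x. - c * f2 x - - c * f1 x)" by (simp add: * algebra_simps)
    ultimately show ?thesis by (rule A_s_I)
  qed
qed

lemma A_s_affine: "f \<in> A_s X \<Longrightarrow> affine_fun_on X f"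
  using affine_fun_on_lincomb[of X _ _ 1 "- 1" 0] by (auto simp: A_s_def A_l_def)

lemma A_s_bounded:
  assumes "compact X" "convex X" "f \<in> A_s X"
  shows "bounded (f ` X)"
  using assms(3) bounded_minus_comp[OF A_l_bounded[OF assms(1,2)] A_l_bounded[OF assms(1,2)]]
  by (auto simp: A_s_def)

lemma A_l_subset_A_s: "f \<in> A_l X \<Longrightarrow> f \<in> A_s X"
  using A_l_const[of 0 X] by (intro A_s_I[of f X "\<lambda>_. 0"]) auto

theorem intermediate_function_space_sigma_A_s:
  assumes X: "compact X" "convex X"
  shows "intermediate_function_space X (sigma_closure X (A_s X))"
  unfolding intermediate_function_space_def
proof (intro conjI ballI allI impI)
  note bdd = A_s_bounded[OF X]
  show "affine_fun_on X f" if "f \<in> sigma_closure X (A_s X)" for f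
    using X(2) A_s_affine that by (rule sigma_closure_affine)
  show "bounded (f ` X)" if "f \<in> sigma_closure X (A_s X)" for f
    using bdd that by (rule sigma_closure_bounded)
  show "f \<in> sigma_closure X (A_s X)" if "affine_fun_on X f \<and> continuous_on X f" for f
    using that by (intro sigma_closure.base A_l_subset_A_s A_l_continuous) auto
  show "(\<lambda>x. f x + g x) \<in> sigma_closure X (A_s X)"
    if "f \<in> sigma_closure X (A_s X)" "g \<in> sigma_closure X (A_s X)" for f g
    using A_s_add bdd that by (rule sigma_closure_add)
  show "(\<lambda>x. c * f x) \<in> sigma_closure X (A_s X)" if "f \<in> sigma_closure X (A_s X)" for f c
    using A_s_mult that by (rule sigma_closure_mult)
  show "f \<in> sigma_closure X (A_s X)"
    if "\<forall>e>0. \<exists>g\<in>sigma_closure X (A_s X). \<forall>x\<in>X. \<bar>f x - g x\<bar> \<le> e" for f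
    using that by (intro sigma_closure_uniform_limit bdd) auto
qed

text \<open>\<open>e\<close> is a random point of a convex set whose barycentre, as far as \<open>F\<close> can tell, is \<open>x\<close>.\<close>

definition represents :: "real measure \<Rightarrow> (real \<Rightarrow> 'a) \<Rightarrow> ('a \<Rightarrow> real) set \<Rightarrow> 'a \<Rightarrow> bool" where
  "represents M e F x \<longleftrightarrow> (\<forall>d\<in>F. (\<lambda>r. d (e r)) \<in> borel_measurable M \<and> (\<integral>r. d (e r) \<partial>M) = d x)"

section \<open>Barycentre formulas under differences and bounded limits\<close>

lemma represents_A_l_diff:
  assumes X: "compact X" "convex X" and M: "prob_space M" and e: "range e \<subseteq> X"
    and fg: "f \<in> A_l X" "g \<in> A_l X" "represents M e {f, g} x"
  shows "represents M e {\<lambda>x. f x - g x} x"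
proof -
  interpret prob_space M by fact
  have "integrable M (\<lambda>r. d (e r))" if d: "d \<in> {f, g}" for d
  proof -
    obtain B where B: "\<And>x. x \<in> X \<Longrightarrow> \<bar>d x\<bar> \<le> B"
      using A_l_bounded[OF X, of d] d fg(1,2) by (auto simp: bounded_iff)
    have "(\<lambda>r. d (e r)) \<in> borel_measurable M" using fg(3) d by (auto simp: represents_def)
    moreover have "norm (d (e r)) \<le> B" for r using B[of "e r"] e by auto
    ultimately show ?thesis by (intro integrable_const_bound[where B = B]) auto
  qed
  then show ?thesis using fg(3) by (simp add: represents_def)
qed

lemma represents_limit:
  assumes M: "prob_space M" and e: "range e \<subseteq> X" and x: "x \<in> X"
    and f: "\<And>n. represents M e {f n} x" and C: "\<And>n x. x \<in> X \<Longrightarrow> \<bar>f n x\<bar> \<le> C"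
    and lim: "\<And>x. x \<in> X \<Longrightarrow> (\<lambda>n. f n x) \<longlonglongrightarrow> g x"
  shows "represents M e {g} x"
proof -
  interpret prob_space M by fact
  have f: "(\<lambda>r. f n (e r)) \<in> borel_measurable M" "(\<integral>r. f n (e r) \<partial>M) = f n x" for n
    using f by (auto simp: represents_def)
  have lim_e: "(\<lambda>n. f n (e r)) \<longlonglongrightarrow> g (e r)" for r using lim e by auto
  have meas: "(\<lambda>r. g (e r)) \<in> borel_measurable M"
    by (rule borel_measurable_LIMSEQ_real[OF lim_e f(1)])
  have "norm (f n (e r)) \<le> C" for n r using C[of "e r" n] e by auto
  then have "(\<lambda>n. \<integral>r. f n (e r) \<partial>M) \<longlonglongrightarrow> (\<integral>r. g (e r) \<partial>M)"
    by (intro integral_dominated_convergence[where w = "\<lambda>_. C"] meas f(1) always_eventually AE_I2 allI lim_e)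
      auto
  then have "(\<integral>r. g (e r) \<partial>M) = g x"
    using lim[OF x] unfolding f(2) by (rule LIMSEQ_unique)
  then show ?thesis using meas by (simp add: represents_def)
qed

text \<open>\<open>D\<close> depends on \<open>u\<close> alone, since the measure is constructed
  from \<open>D\<close> afterwards. A limit step takes a countable union of countable families, so
  countability survives the whole induction.\<close>

lemma sigma_closure_A_s_represents:
  fixes X :: "'a::locally_convex_space set"
  assumes X: "compact X" "convex X" and u: "u \<in> sigma_closure X (A_s X)"
  shows "\<exists>D. countable D \<and> D \<subseteq> A_l X \<and>
    (\<forall>M e x. prob_space M \<longrightarrow> range e \<subseteq> X \<longrightarrow> x \<in> X \<longrightarrow> represents M e D x \<longrightarrow> represents M e {u} x)"
  using u
proof induction
  case (base u)
  then obtain f g where fg: "f \<in> A_l X" "g \<in> A_l X" "u = (\<lambda>x. f x - g x)" by (auto simp: A_s_def)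
  show ?case
    unfolding fg(3) using fg(1,2) represents_A_l_diff[OF X _ _ fg(1,2)] by (intro exI[of _ "{f, g}"]) simp
next
  case (limit f g)
  from limit.IH obtain D where D: "\<And>n. countable (D n)" "\<And>n. D n \<subseteq> A_l X"
    "\<And>n M e x. prob_space M \<Longrightarrow> range e \<subseteq> X \<Longrightarrow> x \<in> X \<Longrightarrow> represents M e (D n) x \<Longrightarrow> represents M e {f n} x"
    by metis
  obtain C where C: "\<And>n x. x \<in> X \<Longrightarrow> \<bar>f n x\<bar> \<le> C" using limit.hyps(2) by blast
  show ?case
  proof (intro exI[of _ "\<Union>n. D n"] conjI allI impI)
    show "countable (\<Union>n. D n)" "(\<Union>n. D n) \<subseteq> A_l X" using D(1,2) by auto
    fix M :: "real measure" and e x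
    assume *: "prob_space M" "range e \<subseteq> X" "x \<in> X" and "represents M e (\<Union>n. D n) x"
    then have "represents M e (D n) x" for n by (auto simp: represents_def)
    from D(3)[OF * this] show "represents M e {g} x"
      using C limit.hyps(3) by (rule represents_limit[OF *])
  qed
qed

subsection \<open>Schoenberg's space-filling curve\<close>

lemma continuous_on_suminf_M_test:
  fixes f :: "nat \<Rightarrow> real \<Rightarrow> real"
  assumes "\<And>n. continuous_on UNIV (f n)" "\<And>n x. \<bar>f n x\<bar> \<le> B n" "summable B"
  shows "continuous_on UNIV (\<lambda>x. \<Sum>n. f n x)"
proof (rule uniform_limit_theorem)
  show "uniform_limit UNIV (\<lambda>n x. \<Sum>i<n. f i x) (\<lambda>x. \<Sum>n. f n x) sequentially"
    by (rule Weierstrass_m_test[OF _ assms(3)]) (simp add: assms(2))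
  show "\<forall>\<^sub>F n in sequentially. continuous_on UNIV (\<lambda>x. \<Sum>i<n. f i x)"
    by (intro always_eventually allI continuous_on_sum assms)
qed simp

lemma binary_expansion:
  assumes "c \<in> {0..1::real}"
  obtains b :: "nat \<Rightarrow> real" where "\<And>j. b j \<in> {0, 1}" "(\<lambda>j. b j / 2 ^ Suc j) sums c"
proof -
  \<comment> \<open>\<open>r n\<close> is \<open>2 ^ n\<close> times the remainder after
    \<open>n\<close> digits. As the digit is 1 already at \<open>1/2\<close>, the remainders stay in
    the closed unit interval, and \<open>c = 1\<close> gets the digit 1 throughout.\<close>
  define r where "r = rec_nat c (\<lambda>_ x. if x \<ge> 1/2 then 2 * x - 1 else 2 * x)"
  define b :: "nat \<Rightarrow> real" where "b j = (if r j \<ge> 1/2 then 1 else 0)" for j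
  have r: "r 0 = c" "r (Suc n) = 2 * r n - b n" for n by (auto simp: r_def b_def)
  have r01: "r n \<in> {0..1}" for n
    by (induction n) (use assms r in \<open>auto simp: b_def\<close>)
  have "c - (\<Sum>j<n. b j / 2 ^ Suc j) = r n / 2 ^ n" for n
    by (induction n) (auto simp: r field_simps)
  then have eq: "(\<Sum>j<n. b j / 2 ^ Suc j) = c - r n / 2 ^ n" for n by (simp add: algebra_simps)
  have "(\<lambda>n. r n / 2 ^ n) \<longlonglongrightarrow> 0"
  proof (rule Lim_null_comparison)
    show "\<forall>\<^sub>F n in sequentially. norm (r n / 2 ^ n) \<le> (1/2) ^ n"
      using r01 by (auto simp: field_simps)
    show "(\<lambda>n. (1/2) ^ n :: real) \<longlonglongrightarrow> 0" by (intro LIMSEQ_power_zero) auto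
  qed
  then have "(\<lambda>n. c - r n / 2 ^ n) \<longlonglongrightarrow> c - 0" by (intro tendsto_intros)
  then have "(\<lambda>j. b j / 2 ^ Suc j) sums c" unfolding sums_def eq by simp
  then show ?thesis using that[of b] by (auto simp: b_def)
qed

text \<open>The 2-periodic function of Schoenberg's construction, which is 0 on the first and 1 on
  the last third of the unit interval. A clipped cosine achieves this because
  \<open>cos (pi / 3) = 1/2\<close> and \<open>cos (2 * pi / 3) = - 1/2\<close>; continuity and the
  period come for free.\<close>

definition tooth :: "real \<Rightarrow> real" where
  "tooth t = max 0 (min 1 (1/2 - cos (pi * t)))"

lemma tooth_bounds: "0 \<le> tooth t" "tooth t \<le> 1"
  by (auto simp: tooth_def)

lemma tooth_continuous: "continuous_on S tooth"
  unfolding tooth_def by (intro continuous_intros)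

lemma tooth_periodic: "tooth (2 * of_int n + t) = tooth t"
proof -
  have "cos (pi * (2 * of_int n + t)) = cos (2 * pi * of_int n + pi * t)" by (simp add: algebra_simps)
  also have "\<dots> = cos (pi * t)"
    by (simp only: cos_add cos_int_2pin sin_int_2pin mult_1 mult_zero_left diff_zero)
  finally show ?thesis by (simp add: tooth_def)
qed

lemma tooth_0: "0 \<le> t \<Longrightarrow> t \<le> 1/3 \<Longrightarrow> tooth t = 0"
  using cos_monotone_0_pi_le[of "pi * t" "pi / 3"] cos_60 by (simp add: tooth_def field_simps)

lemma tooth_1: "2/3 \<le> t \<Longrightarrow> t \<le> 1 \<Longrightarrow> tooth t = 1"
  using cos_monotone_0_pi_le[of "2 * pi / 3" "pi * t"] cos_120 by (simp add: tooth_def field_simps)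

text \<open>For \<open>t\<close> in the Cantor set, \<open>tooth (3 ^ n * t)\<close> reads off a
  ternary digit of \<open>t\<close>, halved. The pairing function deals these digits out to
  infinitely many coordinates, each of which uses its share as a binary expansion.\<close>

definition schoenberg :: "nat \<Rightarrow> real \<Rightarrow> real" where
  "schoenberg k t = (\<Sum>j. tooth (3 ^ prod_encode (k, j) * t) / 2 ^ Suc j)"

lemma summable_half: "summable (\<lambda>j. 1 / 2 ^ Suc j :: real)"
  using power_half_series by (simp add: sums_iff power_one_over)

lemma suminf_half: "(\<Sum>j. 1 / 2 ^ Suc j :: real) = 1"
  using power_half_series by (simp add: sums_iff power_one_over)

lemma schoenberg_summable: "summable (\<lambda>j. tooth (3 ^ prod_encode (k, j) * t) / 2 ^ Suc j)"
  by (rule summable_comparison_test'[OF summable_half, of 0])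
    (use tooth_bounds in \<open>auto simp: divide_simps\<close>)

lemma schoenberg_continuous: "continuous_on UNIV (schoenberg k)"
  unfolding schoenberg_def
proof (rule continuous_on_suminf_M_test[OF _ _ summable_half])
  show "continuous_on UNIV (\<lambda>t. tooth (3 ^ prod_encode (k, j) * t) / 2 ^ Suc j)" for j
    by (intro continuous_intros continuous_on_compose2[OF tooth_continuous]) auto
  show "\<bar>tooth (3 ^ prod_encode (k, j) * t) / 2 ^ Suc j\<bar> \<le> 1 / 2 ^ Suc j" for j t
    using tooth_bounds by (auto simp: divide_simps)
qed

lemma schoenberg_bounds: "schoenberg k t \<in> {0..1}"
proof -
  have "0 \<le> schoenberg k t"
    unfolding schoenberg_def using tooth_bounds by (intro suminf_nonneg schoenberg_summable) auto
  moreover have "schoenberg k t \<le> (\<Sum>j. 1 / 2 ^ Suc j)"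
    unfolding schoenberg_def
    by (intro suminf_le schoenberg_summable summable_half divide_right_mono tooth_bounds) auto
  ultimately show ?thesis by (simp only: suminf_half) simp
qed

text \<open>\<open>T a\<close> is the point of the Cantor set with ternary digits
  \<open>2 * a i\<close>. Multiplication by 3 shifts the digits and adds the even number
  \<open>2 * a 0\<close>, which the period of \<open>tooth\<close> absorbs even after further
  multiplication by powers of 3. This leaves \<open>n = 0\<close>, where \<open>T a\<close> lies in
  the outer third selected by \<open>a 0\<close>.\<close>

lemma tooth_ternary:
  fixes a :: "nat \<Rightarrow> real"
  assumes a: "\<And>i. a i \<in> {0, 1}"
  defines "T \<equiv> \<lambda>a :: nat \<Rightarrow> real. \<Sum>i. 2 * a i / 3 ^ Suc i"
  shows "T a \<in> {0..1}" "tooth (3 ^ n * T a) = a n"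
proof -
  have third: "(\<lambda>i. 2 / 3 ^ Suc i :: real) sums 1"
    using sums_mult[OF geometric_sums[of "1/3::real"], of "2/3"] by (simp add: field_simps power_one_over)
  have sm: "summable (\<lambda>i. 2 * a i / 3 ^ Suc i)" if "\<And>i. a i \<in> {0, 1}" for a :: "nat \<Rightarrow> real"
  proof (rule summable_comparison_test'[of _ 0])
    show "summable (\<lambda>i. 2 / 3 ^ Suc i :: real)" using third by (rule sums_summable)
    show "norm (2 * a i / 3 ^ Suc i) \<le> 2 / 3 ^ Suc i" for i using that[of i] by auto
  qed
  have T01: "T a \<in> {0..1}" if a: "\<And>i. a i \<in> {0, 1}" for a
  proof -
    have "0 \<le> 2 * a i / 3 ^ Suc i" "2 * a i / 3 ^ Suc i \<le> 2 / 3 ^ Suc i" for i using a[of i] by auto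
    then have "0 \<le> T a" "T a \<le> (\<Sum>i. 2 / 3 ^ Suc i)"
      unfolding T_def using a sm third by (intro suminf_nonneg suminf_le; auto simp: sums_iff)+
    then show ?thesis using third by (simp add: sums_iff)
  qed
  have step: "3 * T a = 2 * a 0 + T (\<lambda>i. a (Suc i))" if a: "\<And>i. a i \<in> {0, 1}" for a
  proof -
    have "T a = 2 * a 0 / 3 + (\<Sum>i. 2 * a (Suc i) / 3 ^ Suc (Suc i))"
      unfolding T_def using suminf_split_initial_segment[OF sm[of a], where k = 1] a by simp
    also have "(\<Sum>i. 2 * a (Suc i) / 3 ^ Suc (Suc i)) = T (\<lambda>i. a (Suc i)) / 3"
      unfolding T_def using suminf_divide[OF sm[of "\<lambda>i. a (Suc i)"], of 3] a by (simp add: field_simps)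
    finally show ?thesis by simp
  qed
  show "T a \<in> {0..1}" using a by (rule T01)
  show "tooth (3 ^ n * T a) = a n"
    using a
  proof (induction n arbitrary: a)
    case 0
    have *: "3 * T a = 2 * a 0 + T (\<lambda>i. a (Suc i))" "T (\<lambda>i. a (Suc i)) \<in> {0..1}"
      using step[of a] T01[of "\<lambda>i. a (Suc i)"] 0 by auto
    consider "a 0 = 0" | "a 0 = 1" using 0[of 0] by auto
    then show ?case
    proof cases
      case 1 then show ?thesis using * tooth_0[of "T a"] by simp
    next
      case 2 then show ?thesis using * tooth_1[of "T a"] by simp
    qed
  next
    case (Suc n)
    obtain m :: int where m: "a 0 = of_int m" using Suc.prems[of 0] by (metis insertE of_int_0 of_int_1 singletonD)
    have "3 ^ Suc n * T a = 3 ^ n * (3 * T a)" by simp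
    also have "\<dots> = 2 * of_int (3 ^ n * m) + 3 ^ n * T (\<lambda>i. a (Suc i))"
      unfolding step[of a, OF Suc.prems] m by (simp add: algebra_simps)
    finally have "tooth (3 ^ Suc n * T a) = tooth (3 ^ n * T (\<lambda>i. a (Suc i)))"
      by (simp only: tooth_periodic)
    then show ?case using Suc.IH[of "\<lambda>i. a (Suc i)"] Suc.prems by simp
  qed
qed

theorem schoenberg_surj:
  assumes "\<And>k. c k \<in> {0..1}"
  obtains t where "t \<in> {0..1}" "\<And>k. schoenberg k t = c k"
proof -
  have "\<exists>b :: nat \<Rightarrow> real. (\<forall>j. b j \<in> {0, 1}) \<and> (\<lambda>j. b j / 2 ^ Suc j) sums c k" for k
    using binary_expansion[OF assms[of k]] by metis
  then obtain b :: "nat \<Rightarrow> nat \<Rightarrow> real" where b: "\<And>k j. b k j \<in> {0, 1}" "\<And>k. (\<lambda>j. b k j / 2 ^ Suc j) sums c k"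
    by metis
  define a where "a i = (case prod_decode i of (k, j) \<Rightarrow> b k j)" for i
  have a: "a i \<in> {0, 1}" for i using b(1) by (auto simp: a_def split: prod.split)
  define t where "t = (\<Sum>i. 2 * a i / 3 ^ Suc i)"
  have "t \<in> {0..1}" "tooth (3 ^ prod_encode (k, j) * t) = b k j" for k j
    using tooth_ternary[OF a] by (auto simp: t_def a_def)
  then show ?thesis using that[of t] b(2) by (simp add: schoenberg_def sums_iff)
qed

subsection \<open>The Riesz representation theorem on a compact interval\<close>

lemma bcontfun_add: "f \<in> bcontfun \<Longrightarrow> g \<in> bcontfun \<Longrightarrow> (\<lambda>x. f x + g x :: real) \<in> bcontfun"
  by (rule plus_cont)

lemma bcontfun_mult: "f \<in> bcontfun \<Longrightarrow> (\<lambda>x. c * f x :: real) \<in> bcontfun"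
  using scaleR_cont[of f c] by simp

lemma bcontfun_sum: "finite I \<Longrightarrow> (\<And>i. i \<in> I \<Longrightarrow> f i \<in> bcontfun) \<Longrightarrow> (\<lambda>x. \<Sum>i\<in>I. f i x :: real) \<in> bcontfun"
  by (induction I rule: finite_induct) (auto intro: bcontfun_add const_bcontfun)

text \<open>For \<open>s < t\<close>, a continuous function between the indicators of
  \<open>{..s}\<close> and \<open>{..t}\<close>. Its value under a functional can therefore be
  compared with the values of a distribution function at \<open>s\<close> and
  \<open>t\<close>.\<close>

definition ramp :: "real \<Rightarrow> real \<Rightarrow> real \<Rightarrow> real" where
  "ramp s t r = max 0 (min 1 ((t - r) / (t - s)))"

lemma ramp_bounds: "0 \<le> ramp s t r" "ramp s t r \<le> 1"
  by (auto simp: ramp_def)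

lemma ramp_left: "s < t \<Longrightarrow> r \<le> s \<Longrightarrow> ramp s t r = 1"
  by (simp add: ramp_def)

lemma ramp_right: "s < t \<Longrightarrow> t \<le> r \<Longrightarrow> ramp s t r = 0"
  by (simp add: ramp_def divide_nonpos_pos)

lemma ramp_bcontfun: "s < t \<Longrightarrow> ramp s t \<in> bcontfun"
  unfolding ramp_def by (rule bcontfun_normI[where b = 1]) (auto intro!: continuous_intros)

text \<open>The piecewise linear interpolant at equidistant nodes, summed by increments. In this
  form a linear functional applied to it involves only values at ramps, weighted with increments of
  size at most \<open>e\<close>.\<close>

lemma interpolate_by_ramps:
  fixes f :: "real \<Rightarrow> real"
  assumes f: "continuous_on {-1..1} f" and e: "e > 0"
  obtains n :: nat and t where "t 0 = -1" "t n = 1" "\<And>i. t i < t (Suc i)"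
    "\<And>i. i < n \<Longrightarrow> \<bar>f (t (Suc i)) - f (t i)\<bar> \<le> e"
    "\<And>r. r \<in> {-1..1} \<Longrightarrow> \<bar>f r - (f (t 0) + (\<Sum>i<n. (f (t (Suc i)) - f (t i)) * (1 - ramp (t i) (t (Suc i)) r)))\<bar> \<le> e"
proof -
  have "uniformly_continuous_on {-1..1} f"
    using f by (intro compact_uniformly_continuous) auto
  then obtain d where d: "d > 0"
    "\<And>x y. x \<in> {-1..1} \<Longrightarrow> y \<in> {-1..1} \<Longrightarrow> \<bar>x - y\<bar> < d \<Longrightarrow> \<bar>f x - f y\<bar> < e / 2"
    unfolding uniformly_continuous_on_def dist_real_def using e by (metis half_gt_zero)
  obtain n :: nat where n: "real n > 2 / d" using reals_Archimedean2 by blast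
  have n0: "real n > 0" using n d(1) by (meson divide_pos_pos less_trans zero_less_numeral)
  define t where "t i = -1 + 2 * real i / n" for i :: nat
  have tS: "t (Suc i) = t i + 2 / n" for i by (simp add: t_def add_divide_distrib)
  have gap: "2 / real n < d" using n n0 d(1) by (simp add: field_simps)
  have t: "t i \<in> {-1..1}" if "i \<le> n" for i using that n0 by (auto simp: t_def field_simps)
  have mono: "t i \<le> t j" if "i \<le> j" for i j
    using that n0 by (auto simp: t_def divide_right_mono)
  have inc: "t i < t (Suc i)" for i using n0 by (simp add: tS)
  have step: "\<bar>f (t (Suc i)) - f (t i)\<bar> < e / 2" if "i < n" for i
    using that t[of i] t[of "Suc i"] gap n0 by (intro d(2)) (auto simp: tS)
  show ?thesis
  proof (rule that[of t n])
    show "t 0 = -1" "t n = 1" "t i < t (Suc i)" for i using n0 inc by (auto simp: t_def)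
    show "\<bar>f (t (Suc i)) - f (t i)\<bar> \<le> e" if "i < n" for i using step[OF that] e by simp
    fix r :: real assume r: "r \<in> {-1..1}"
    \<comment> \<open>Increments up to a node \<open>t m \<le> r\<close> enter in full, those of
      cells beyond \<open>r\<close> not at all; only the cell around \<open>r\<close> contributes a
      fraction.\<close>
    define S where "S m = f (t 0) + (\<Sum>i<m. (f (t (Suc i)) - f (t i)) * (1 - ramp (t i) (t (Suc i)) r))" for m
    have left: "S m = f (t m)" if "t m \<le> r" for m
      using that
    proof (induction m)
      case (Suc m)
      then show ?case using inc[of m] by (simp add: S_def ramp_right)
    qed (simp add: S_def)
    have right: "S m = S k" if "k \<le> m" "r \<le> t k" for k m
      using that(1)
    proof (induction rule: dec_induct)
      case (step m)
      have "r \<le> t m" using that(2) mono[OF step(1)] by simp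
      then show ?case using step inc[of m] by (simp add: S_def ramp_left)
    qed simp
    have "\<bar>f r - S n\<bar> \<le> e"
    proof (cases "r = 1")
      case True
      then show ?thesis using left[of n] n0 e by (simp add: t_def)
    next
      case False
      \<comment> \<open>Index of the cell that contains \<open>r\<close>. For \<open>r = 1\<close>
        it would be \<open>n\<close>, one too many, hence the case distinction.\<close>
      define k where "k = nat \<lfloor>(r + 1) * n / 2\<rfloor>"
      have fl: "real k = of_int \<lfloor>(r + 1) * n / 2\<rfloor>" using r n0 by (simp add: k_def)
      have k: "real k \<le> (r + 1) * n / 2" "(r + 1) * n / 2 < real k + 1"
        unfolding fl by linarith+
      have "t k \<le> r" "r < t (Suc k)" using k n0 by (simp_all add: t_def field_simps)
      moreover have "k < n"
      proof -
        have "(r + 1) * real n < 2 * real n" using r False n0 by (intro mult_strict_right_mono) auto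
        then show ?thesis using k by linarith
      qed
      ultimately have "S n = S (Suc k)" and Sk: "S k = f (t k)"
        using right[of "Suc k" n] left[of k] by auto
      then have "S n = f (t k) + (f (t (Suc k)) - f (t k)) * (1 - ramp (t k) (t (Suc k)) r)"
        by (simp add: S_def)
      moreover have "\<bar>(f (t (Suc k)) - f (t k)) * (1 - ramp (t k) (t (Suc k)) r)\<bar> \<le> e / 2 * 1"
        unfolding abs_mult using step[OF \<open>k < n\<close>] ramp_bounds e by (intro mult_mono) auto
      moreover have "\<bar>f r - f (t k)\<bar> < e / 2"
        using \<open>t k \<le> r\<close> \<open>r < t (Suc k)\<close> gap t[of k] \<open>k < n\<close> r by (intro d(2)) (auto simp: tS)
      ultimately show ?thesis by linarith
    qed
    then show "\<bar>f r - (f (t 0) + (\<Sum>i<n. (f (t (Suc i)) - f (t i)) * (1 - ramp (t i) (t (Suc i)) r)))\<bar> \<le> e"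
      by (simp add: S_def)
  qed
qed

text \<open>Positive normalised functionals supported in \<open>{-1..1}\<close>; the support is
  expressed by where positivity is tested. The domain \<open>bcontfun\<close> is the carrier of a
  vector space type, on which the sublinear Hahn--Banach theorem can act.\<close>

locale state_on_interval =
  fixes \<Lambda> :: "(real \<Rightarrow> real) \<Rightarrow> real"
  assumes add: "f \<in> bcontfun \<Longrightarrow> g \<in> bcontfun \<Longrightarrow> \<Lambda> (\<lambda>x. f x + g x) = \<Lambda> f + \<Lambda> g"
    and mult: "f \<in> bcontfun \<Longrightarrow> \<Lambda> (\<lambda>x. c * f x) = c * \<Lambda> f"
    and nonneg: "f \<in> bcontfun \<Longrightarrow> (\<And>x. x \<in> {-1..1} \<Longrightarrow> 0 \<le> f x) \<Longrightarrow> 0 \<le> \<Lambda> f"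
    and one: "\<Lambda> (\<lambda>_. 1) = 1"
begin

lemma const: "\<Lambda> (\<lambda>_. c) = c"
  using mult[OF const_bcontfun[of 1], of c] one by simp

lemma mono:
  assumes "f \<in> bcontfun" "g \<in> bcontfun" "\<And>x. x \<in> {-1..1} \<Longrightarrow> f x \<le> g x"
  shows "\<Lambda> f \<le> \<Lambda> g"
proof -
  have "0 \<le> \<Lambda> (\<lambda>x. g x + (-1) * f x)"
    using assms by (intro nonneg bcontfun_add bcontfun_mult) auto
  also have "\<dots> = \<Lambda> g - \<Lambda> f" using assms by (subst add) (auto simp: mult[of f "-1", simplified] intro: bcontfun_mult[of f "-1", simplified])
  finally show ?thesis by simp
qed

lemma sum: "finite I \<Longrightarrow> (\<And>i. i \<in> I \<Longrightarrow> f i \<in> bcontfun) \<Longrightarrow> \<Lambda> (\<lambda>x. \<Sum>i\<in>I. f i x) = (\<Sum>i\<in>I. \<Lambda> (f i))"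
  by (induction I rule: finite_induct) (auto simp: const add bcontfun_sum)

lemma bound:
  assumes "f \<in> bcontfun" "\<And>x. x \<in> {-1..1} \<Longrightarrow> \<bar>f x\<bar> \<le> e"
  shows "\<bar>\<Lambda> f\<bar> \<le> e"
proof -
  have le: "f x \<le> e" "- e \<le> f x" if "x \<in> {-1..1}" for x using assms(2)[OF that] by auto
  have "\<Lambda> f \<le> \<Lambda> (\<lambda>_. e)" using le by (intro mono assms const_bcontfun) auto
  moreover have "\<Lambda> (\<lambda>_. - e) \<le> \<Lambda> f" using le by (intro mono assms const_bcontfun) auto
  ultimately show ?thesis by (simp add: const)
qed

lemma interpolation:
  assumes "\<And>i. t i < t (Suc i)"
  shows "\<Lambda> (\<lambda>r. c + (\<Sum>i<n. a i * (1 - ramp (t i) (t (Suc i)) r))) = c + (\<Sum>i<n. a i * (1 - \<Lambda> (ramp (t i) (t (Suc i)))))"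
proof -
  have R: "ramp (t i) (t (Suc i)) \<in> bcontfun" for i using assms by (rule ramp_bcontfun)
  have B: "(\<lambda>r. a i + (- a i) * ramp (t i) (t (Suc i)) r) \<in> bcontfun" for i
    by (intro bcontfun_add bcontfun_mult const_bcontfun R)
  have "\<Lambda> (\<lambda>r. c + (\<Sum>i<n. a i + (- a i) * ramp (t i) (t (Suc i)) r))
      = c + (\<Sum>i<n. \<Lambda> (\<lambda>r. a i + (- a i) * ramp (t i) (t (Suc i)) r))"
    by (subst add, rule const_bcontfun, rule bcontfun_sum) (use B in \<open>auto simp: const sum\<close>)
  also have "\<dots> = c + (\<Sum>i<n. a i + (- a i) * \<Lambda> (ramp (t i) (t (Suc i))))"
    by (simp only: add[OF const_bcontfun bcontfun_mult[OF R]] const mult[OF R])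
  finally show ?thesis by (simp add: right_diff_distrib)
qed

end

text \<open>At each ramp of the interpolant the two functionals differ by at most the increment of
  \<open>G\<close> over that cell, and these increments telescope to \<open>G 1 - G (-1)\<close>,
  with factor \<open>e\<close>. The 2 in \<open>C\<close> pays for replacing \<open>f\<close> by the
  interpolant under both functionals.\<close>

lemma state_on_interval_unique:
  assumes "state_on_interval \<Phi>" "state_on_interval \<Psi>" and f: "f \<in> bcontfun"
    and \<Phi>: "\<And>s t. s < t \<Longrightarrow> G s \<le> \<Phi> (ramp s t) \<and> \<Phi> (ramp s t) \<le> G t"
    and \<Psi>: "\<And>s t. s < t \<Longrightarrow> G s \<le> \<Psi> (ramp s t) \<and> \<Psi> (ramp s t) \<le> G t"
  shows "\<Phi> f = \<Psi> (f :: real \<Rightarrow> real)"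
proof -
  interpret P: state_on_interval \<Phi> by fact
  interpret Q: state_on_interval \<Psi> by fact
  define C where "C = 2 + \<bar>G 1 - G (-1)\<bar>"
  have cont: "continuous_on {-1..1} f" using f by (auto simp: bcontfun_def intro: continuous_on_subset)
  have est: "\<bar>\<Phi> f - \<Psi> f\<bar> \<le> e * C" if e: "e > 0" for e
  proof (rule interpolate_by_ramps[OF cont e])
    fix n :: nat and t
    assume t: "t 0 = -1" "t n = 1" "\<And>i. t i < t (Suc i)"
      and d: "\<And>i. i < n \<Longrightarrow> \<bar>f (t (Suc i)) - f (t i)\<bar> \<le> e"
      and app: "\<And>r. r \<in> {-1..1} \<Longrightarrow> \<bar>f r - (f (t 0) + (\<Sum>i<n. (f (t (Suc i)) - f (t i)) * (1 - ramp (t i) (t (Suc i)) r)))\<bar> \<le> e"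
    define a where "a i = f (t (Suc i)) - f (t i)" for i
    define F where "F r = f (t 0) + (\<Sum>i<n. a i * (1 - ramp (t i) (t (Suc i)) r))" for r
    have F: "F \<in> bcontfun"
    proof -
      have "(\<lambda>r. f (t 0) + (\<Sum>i<n. a i * (1 + (-1) * ramp (t i) (t (Suc i)) r))) \<in> bcontfun"
        using ramp_bcontfun[OF t(3)] by (intro bcontfun_add bcontfun_sum bcontfun_mult const_bcontfun) auto
      then show ?thesis by (simp add: F_def[abs_def])
    qed
    have diff: "(\<lambda>r. f r + (-1) * F r) \<in> bcontfun" using f F by (intro bcontfun_add bcontfun_mult)
    have app': "\<bar>f r + (-1) * F r\<bar> \<le> e" if "r \<in> {-1..1}" for r
      using app[OF that] by (simp add: F_def a_def)
    have "\<bar>\<Phi> (\<lambda>r. f r + (-1) * F r)\<bar> \<le> e" "\<bar>\<Psi> (\<lambda>r. f r + (-1) * F r)\<bar> \<le> e"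
      using P.bound[OF diff app'] Q.bound[OF diff app'] by simp_all
    then have fF: "\<bar>\<Phi> f - \<Phi> F\<bar> \<le> e" "\<bar>\<Psi> f - \<Psi> F\<bar> \<le> e"
      using P.add[OF f bcontfun_mult[OF F]] Q.add[OF f bcontfun_mult[OF F]] P.mult[OF F] Q.mult[OF F]
      by (simp_all only:)
    have "\<Phi> F - \<Psi> F = (\<Sum>i<n. a i * (\<Psi> (ramp (t i) (t (Suc i))) - \<Phi> (ramp (t i) (t (Suc i)))))"
      unfolding F_def[abs_def] P.interpolation[of t, OF t(3)] Q.interpolation[of t, OF t(3)]
      by (simp add: sum_subtractf[symmetric] algebra_simps)
    also have "\<bar>\<dots>\<bar> \<le> (\<Sum>i<n. e * (G (t (Suc i)) - G (t i)))"
    proof (rule order_trans[OF sum_abs sum_mono])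
      fix i assume "i \<in> {..<n}"
      moreover have "\<bar>\<Psi> (ramp (t i) (t (Suc i))) - \<Phi> (ramp (t i) (t (Suc i)))\<bar> \<le> G (t (Suc i)) - G (t i)"
        using \<Phi>[OF t(3)[of i]] \<Psi>[OF t(3)[of i]] by linarith
      ultimately show "\<bar>a i * (\<Psi> (ramp (t i) (t (Suc i))) - \<Phi> (ramp (t i) (t (Suc i))))\<bar> \<le> e * (G (t (Suc i)) - G (t i))"
        unfolding abs_mult using d[of i] e by (intro mult_mono) (auto simp: a_def)
    qed
    also have "\<dots> = e * (G 1 - G (-1))"
      using sum_lessThan_telescope[of "\<lambda>i. G (t i)" n] t by (simp add: sum_distrib_left[symmetric])
    also have "\<dots> \<le> e * \<bar>G 1 - G (-1)\<bar>" using e by (intro mult_left_mono) auto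
    finally show "\<bar>\<Phi> f - \<Psi> f\<bar> \<le> e * C" using fF by (simp add: C_def distrib_left)
  qed
  have "\<bar>\<Phi> f - \<Psi> f\<bar> \<le> 0"
  proof (rule field_le_epsilon)
    fix d :: real assume "d > 0"
    moreover have "C > 0" by (simp add: C_def)
    ultimately show "\<bar>\<Phi> f - \<Psi> f\<bar> \<le> 0 + d" using est[of "d / C"] by simp
  qed
  then show ?thesis by simp
qed

text \<open>The support of \<open>\<Lambda>\<close> is kept away from the left end point of \<open>{-1..1}\<close> so that the distribution
  function below vanishes there.\<close>

theorem riesz_representation_interval:
  assumes L: "state_on_interval \<Lambda>"
    and nonneg: "\<And>f. f \<in> bcontfun \<Longrightarrow> (\<And>x. x \<in> {0..1} \<Longrightarrow> 0 \<le> f x) \<Longrightarrow> 0 \<le> \<Lambda> f"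
  obtains M where "real_distribution M" "\<And>f. f \<in> bcontfun \<Longrightarrow> (\<integral>r. f r \<partial>M) = \<Lambda> f"
proof -
  interpret L: state_on_interval \<Lambda> by fact
  \<comment> \<open>Majorants of the indicator of \<open>{..t}\<close> that stay at least 1 slightly
    beyond \<open>t\<close>. This margin makes the infimum \<open>G\<close>, the future distribution
    function, right continuous.\<close>
  define F :: "real \<Rightarrow> (real \<Rightarrow> real) set" where "F t = {f \<in> bcontfun. (\<forall>r. 0 \<le> f r) \<and> (\<exists>u>t. \<forall>r\<le>u. 1 \<le> f r)}" for t
  define G where "G t = (INF f\<in>F t. \<Lambda> f)" for t
  have one_in: "(\<lambda>_. 1) \<in> F t" for t
    by (auto simp: F_def const_bcontfun intro: gt_ex)
  have F0: "0 \<le> \<Lambda> f" if "f \<in> F t" for f t using that by (intro L.nonneg) (auto simp: F_def)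
  then have bdd: "bdd_below (\<Lambda> ` F t)" for t by (intro bdd_belowI2)
  have low: "G t \<le> \<Lambda> f" if "f \<in> F t" for f t unfolding G_def by (intro cINF_lower bdd that)
  have great: "m \<le> G t" if "\<And>f. f \<in> F t \<Longrightarrow> m \<le> \<Lambda> f" for m t
    unfolding G_def using one_in that by (intro cINF_greatest) auto
  have F1: "1 \<le> f r" if "f \<in> F t" "r \<le> t" for f r t
  proof -
    obtain u where "t < u" "\<And>r. r \<le> u \<Longrightarrow> 1 \<le> f r" using \<open>f \<in> F t\<close> by (auto simp: F_def)
    then show ?thesis using \<open>r \<le> t\<close> by (meson less_imp_le order_trans)
  qed
  have ramp_le: "\<Lambda> (ramp s t) \<le> G t" if "s < t" for s t
  proof (rule great)
    fix f assume f: "f \<in> F t"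
    have "ramp s t r \<le> f r" for r
    proof (cases "r \<le> t")
      case True then show ?thesis using F1[OF f] ramp_bounds(2)[of s t r] by (meson order_trans)
    next
      case False then show ?thesis using f ramp_right[OF that, of r] by (simp add: F_def)
    qed
    then show "\<Lambda> (ramp s t) \<le> \<Lambda> f" using f ramp_bcontfun[OF that] by (intro L.mono) (auto simp: F_def)
  qed
  have le_ramp: "G s \<le> \<Lambda> (ramp s t)" if "s < t" for s t
  proof -
    have "G s \<le> \<Lambda> (ramp s t) + e" if e: "e > 0" for e
    proof -
      \<comment> \<open>The point where \<open>ramp s t\<close> has fallen to
        \<open>1 / (1 + e)\<close>. Left of it \<open>(1 + e) * ramp s t\<close> is at least 1, so
        this multiple is admissible in the infimum \<open>G s\<close>.\<close>
      define u where "u = t - (t - s) / (1 + e)"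
      have "(t - s) / (1 + e) < t - s" using \<open>s < t\<close> e by (simp add: field_simps)
      then have u: "s < u" by (simp add: u_def)
      have "1 \<le> (1 + e) * ramp s t r" if "r \<le> u" for r
      proof -
        have "(t - s) / (1 + e) \<le> t - r" using that by (simp add: u_def)
        then have "1 / (1 + e) \<le> (t - r) / (t - s)" using \<open>s < t\<close> e by (simp add: field_simps)
        moreover have "1 / (1 + e) \<le> 1" using e by simp
        ultimately have "1 / (1 + e) \<le> ramp s t r" by (simp add: ramp_def)
        then show ?thesis using e by (simp add: field_simps)
      qed
      then have "(\<lambda>r. (1 + e) * ramp s t r) \<in> F s"
        using u e ramp_bounds ramp_bcontfun[OF \<open>s < t\<close>] by (auto simp: F_def intro!: bcontfun_mult)
      from low[OF this] have "G s \<le> \<Lambda> (ramp s t) + e * \<Lambda> (ramp s t)"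
        using L.mult[OF ramp_bcontfun[OF \<open>s < t\<close>], of "1 + e"] by (simp add: distrib_right)
      moreover have "\<Lambda> (ramp s t) \<le> \<Lambda> (\<lambda>_. 1)"
        using ramp_bounds ramp_bcontfun[OF \<open>s < t\<close>] by (intro L.mono const_bcontfun) auto
      then have "e * \<Lambda> (ramp s t) \<le> e * 1" using e L.one by (intro mult_left_mono) auto
      ultimately show ?thesis by linarith
    qed
    then show ?thesis by (rule field_le_epsilon)
  qed
  have Gmono: "G s \<le> G t" if "s \<le> t" for s t
    using that le_ramp[of s t] ramp_le[of s t] by (cases "s = t") auto
  have Gneg: "G t = 0" if "t < 0" for t
  proof -
    \<comment> \<open>This ramp is admissible for \<open>G t\<close> and vanishes on
      \<open>{0..1}\<close>, so by the stronger positivity its value under \<open>\<Lambda>\<close>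
      is 0.\<close>
    have "(\<forall>r\<le>t/2. 1 \<le> ramp (t/2) 0 r)" using that ramp_left[of "t/2" 0] by simp
    then have "ramp (t/2) 0 \<in> F t"
      using that ramp_bounds ramp_bcontfun[of "t/2" 0] by (auto simp: F_def intro!: exI[of _ "t/2"])
    then have "G t \<le> \<Lambda> (ramp (t/2) 0)" by (rule low)
    moreover have "0 \<le> \<Lambda> (\<lambda>r. (-1) * ramp (t/2) 0 r)"
      using that ramp_bcontfun[of "t/2" 0] by (intro nonneg bcontfun_mult) (auto simp: ramp_right)
    then have "\<Lambda> (ramp (t/2) 0) \<le> 0" using that L.mult[OF ramp_bcontfun[of "t/2" 0], of "-1"] by simp
    ultimately show ?thesis using great[of t 0, OF F0[of _ t]] by linarith
  qed
  have Gone: "G t = 1" if "1 \<le> t" for t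
  proof (rule antisym)
    show "G t \<le> 1" using low[OF one_in] L.one by simp
    show "1 \<le> G t"
    proof (rule great)
      fix f assume f: "f \<in> F t"
      have "\<Lambda> (\<lambda>_. 1) \<le> \<Lambda> f" using F1[OF f] that f by (intro L.mono const_bcontfun) (auto simp: F_def)
      then show "1 \<le> \<Lambda> f" using L.one by simp
    qed
  qed
  have Gright: "continuous (at_right a) G" for a
    unfolding continuous_within
  proof (rule tendstoI)
    fix e :: real assume e: "e > 0"
    have "\<exists>f\<in>F a. \<Lambda> f < G a + e"
      using cInf_lessD[of "\<Lambda> ` F a" "G a + e"] one_in e by (auto simp: G_def)
    then obtain f u where f: "f \<in> F a" "\<Lambda> f < G a + e" "a < u" "\<forall>r\<le>u. 1 \<le> f r" by (auto simp: F_def)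
    have "dist (G v) (G a) < e" if "a < v" "v < u" for v
    proof -
      have "f \<in> F v" using f that by (auto simp: F_def)
      then have "G v < G a + e" using low[of f v] f(2) by linarith
      then show ?thesis using Gmono[of a v] that by (simp add: dist_real_def)
    qed
    then show "\<forall>\<^sub>F v in at_right a. dist (G v) (G a) < e"
      using f(3) unfolding eventually_at_right_field by blast
  qed
  have lim: "(G \<longlongrightarrow> 0) at_bot" "(G \<longlongrightarrow> 1) at_top"
    by (rule tendsto_eventually, use Gneg in \<open>auto simp: eventually_at_bot_dense\<close>)
      (rule tendsto_eventually, use Gone in \<open>auto simp: eventually_at_top_linorder\<close>)
  define M where "M = interval_measure G"
  have M: "real_distribution M" unfolding M_def using Gmono Gright lim by (rule real_distribution_interval_measure)
  interpret real_distribution M by fact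
  have cdf: "measure M {..t} = G t" for t
    using cdf_interval_measure[OF Gmono Gright lim(1)] unfolding M_def[symmetric] by (metis cdf_def)
  have int: "integrable M f" if f: "f \<in> bcontfun" for f :: "real \<Rightarrow> real"
  proof -
    obtain B where B: "\<And>r. \<bar>f r\<bar> \<le> B" using f by (auto simp: bcontfun_def bounded_iff)
    have "f \<in> borel_measurable borel" using f by (auto simp: bcontfun_def intro: borel_measurable_continuous_onI)
    then have "f \<in> borel_measurable M" by simp
    then show ?thesis using B by (intro integrable_const_bound[where B = B]) auto
  qed
  have AE: "AE r in M. r \<in> {-1..1}"
  proof -
    have "measure M ({..1} - {..-1}) = 1" using Gone[of 1] Gneg[of "-1"] by (subst finite_measure_Diff) (auto simp: cdf)
    then have "AE r in M. r \<in> {..1} - {..-1}" by (subst (asm) prob_eq_1) auto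
    then show ?thesis by eventually_elim auto
  qed
  have I: "state_on_interval (\<lambda>f. \<integral>r. f r \<partial>M)"
  proof
    fix f g :: "real \<Rightarrow> real" and c :: real assume f: "f \<in> bcontfun"
    show "(\<integral>r. f r + g r \<partial>M) = (\<integral>r. f r \<partial>M) + (\<integral>r. g r \<partial>M)" if "g \<in> bcontfun"
      using int[OF f] int[OF that] by (rule Bochner_Integration.integral_add)
    show "(\<integral>r. c * f r \<partial>M) = c * (\<integral>r. f r \<partial>M)" by simp
    assume nn: "\<And>x. x \<in> {-1..1} \<Longrightarrow> 0 \<le> f x"
    have "AE r in M. 0 \<le> f r" using AE by eventually_elim (rule nn)
    then show "0 \<le> (\<integral>r. f r \<partial>M)" by (rule integral_nonneg_AE)
  qed (use prob_space in simp)
  have "G s \<le> (\<integral>r. ramp s t r \<partial>M)" "(\<integral>r. ramp s t r \<partial>M) \<le> G t" if "s < t" for s t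
  proof -
    have "G s = (\<integral>r. indicator {..s} r \<partial>M)" "G t = (\<integral>r. indicator {..t} r \<partial>M)" by (simp_all add: cdf)
    moreover have ind: "integrable M (\<lambda>r. indicator {..u} r :: real)" for u
      by (rule integrable_real_indicator) (auto simp: emeasure_eq_measure)
    have "(\<integral>r. indicator {..s} r \<partial>M) \<le> (\<integral>r. ramp s t r \<partial>M)"
      by (rule integral_mono[OF ind int[OF ramp_bcontfun[OF that]]])
        (simp add: indicator_def ramp_left[OF that] ramp_bounds)
    moreover have "(\<integral>r. ramp s t r \<partial>M) \<le> (\<integral>r. indicator {..t} r \<partial>M)"
      by (rule integral_mono[OF int[OF ramp_bcontfun[OF that]] ind])
        (simp add: indicator_def ramp_right[OF that] ramp_bounds)
    ultimately show "G s \<le> (\<integral>r. ramp s t r \<partial>M)" "(\<integral>r. ramp s t r \<partial>M) \<le> G t" by simp_all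
  qed
  then have "(\<integral>r. f r \<partial>M) = \<Lambda> f" if "f \<in> bcontfun" for f
    using ramp_le le_ramp by (intro state_on_interval_unique[OF I L that, of G]) auto
  then show ?thesis using that M by blast
qed

subsection \<open>Choquet's theorem\<close>

text \<open>The counterpart of continuous affine functions: \<open>s\<close> maps the line into a
  cube, and these are the affine combinations of the cube's coordinates, pulled back.\<close>

inductive_set affine_combs :: "(nat \<Rightarrow> real \<Rightarrow> real) \<Rightarrow> (real \<Rightarrow> real) set" for s where
  const: "(\<lambda>_. c) \<in> affine_combs s"
| gen: "s k \<in> affine_combs s"
| add: "f \<in> affine_combs s \<Longrightarrow> g \<in> affine_combs s \<Longrightarrow> (\<lambda>r. f r + g r) \<in> affine_combs s"
| mult: "f \<in> affine_combs s \<Longrightarrow> (\<lambda>r. c * f r) \<in> affine_combs s"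

lemma affine_combs_bcontfun:
  assumes "\<And>k. s k \<in> bcontfun" "f \<in> affine_combs s" shows "f \<in> bcontfun"
  using assms(2) by induction (auto intro: assms(1) const_bcontfun bcontfun_add bcontfun_mult)

lemma affine_combs_convex:
  assumes "f \<in> affine_combs s" "\<And>k. s k r = (1 - t) * s k r1 + t * s k r2"
  shows "f r = (1 - t) * f r1 + t * f r2"
  using assms(1)
proof induction
  case (mult f c)
  then show ?case by (simp only:) (simp add: algebra_simps)
qed (auto simp: assms(2) algebra_simps)

text \<open>A continuous, strictly convex function of the coordinates; points where affine majorants
  come arbitrarily close to it are extreme.\<close>

definition sq_series :: "(nat \<Rightarrow> real \<Rightarrow> real) \<Rightarrow> real \<Rightarrow> real" where
  "sq_series s r = (\<Sum>k. (s k r)\<^sup>2 / 2 ^ Suc k)"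

lemma sq_le_1: "x \<in> {-1..1::real} \<Longrightarrow> x\<^sup>2 \<le> 1"
  using abs_square_le_1[of x] by (simp add: abs_le_iff)

lemma summable_sq:
  assumes "\<And>k. x k \<in> {-1..1::real}" shows "summable (\<lambda>k. (x k)\<^sup>2 / 2 ^ Suc k)"
proof (rule summable_comparison_test'[OF summable_half, of 0])
  show "norm ((x k)\<^sup>2 / 2 ^ Suc k) \<le> 1 / 2 ^ Suc k" for k
    using sq_le_1[OF assms[of k]] by (simp add: divide_right_mono)
qed

lemma sq_series_bcontfun:
  assumes "\<And>k. continuous_on UNIV (s k)" "\<And>k r. s k r \<in> {0..1}"
  shows "sq_series s \<in> bcontfun"
proof (rule bcontfun_normI[where b = 1])
  have s: "s k r \<in> {-1..1}" for k r using assms(2)[of k r] by auto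
  show "continuous_on UNIV (sq_series s)"
    unfolding sq_series_def
  proof (rule continuous_on_suminf_M_test[OF _ _ summable_half])
    show "continuous_on UNIV (\<lambda>r. (s k r)\<^sup>2 / 2 ^ Suc k)" for k by (intro continuous_intros assms) auto
    show "\<bar>(s k r)\<^sup>2 / 2 ^ Suc k\<bar> \<le> 1 / 2 ^ Suc k" for k r
      using sq_le_1[OF s[of k r]] by (simp add: divide_right_mono)
  qed
  fix r
  have "0 \<le> sq_series s r"
    unfolding sq_series_def using s by (intro suminf_nonneg summable_sq) auto
  moreover have "sq_series s r \<le> (\<Sum>k. 1 / 2 ^ Suc k)"
    unfolding sq_series_def using s sq_le_1[OF s]
    by (intro suminf_le summable_sq summable_half divide_right_mono) auto
  ultimately show "norm (sq_series s r) \<le> 1" by (simp only: suminf_half) simp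
qed

text \<open>The weighted sum of \<open>(1 - t) * a\<^sup>2 + t * b\<^sup>2 - ((1 - t) * a + t *
  b)\<^sup>2 = t * (1 - t) * (a - b)\<^sup>2\<close> over all coordinates. For
  \<open>0 < t < 1\<close> this convexity defect vanishes only if the end points have the same
  coordinates.\<close>

lemma sq_series_convex:
  assumes s: "\<And>k r. s k r \<in> {0..1}" and r: "\<And>k. s k r = (1 - t) * s k r1 + t * s k r2"
  shows "(1 - t) * sq_series s r1 + t * sq_series s r2 - sq_series s r
    = t * (1 - t) * (\<Sum>k. (s k r1 - s k r2)\<^sup>2 / 2 ^ Suc k)"
proof -
  have sm: "summable (\<lambda>k. (s k r)\<^sup>2 / 2 ^ Suc k)" for r
    by (rule summable_sq) (use s in \<open>auto intro: order_trans[of _ 0]\<close>)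
  have sd: "summable (\<lambda>k. (s k r1 - s k r2)\<^sup>2 / 2 ^ Suc k)"
  proof (rule summable_sq)
    show "s k r1 - s k r2 \<in> {-1..1}" for k using s[of k r1] s[of k r2] by auto
  qed
  have "(s k r)\<^sup>2 / 2 ^ Suc k + t * (1 - t) * ((s k r1 - s k r2)\<^sup>2 / 2 ^ Suc k)
      = (1 - t) * ((s k r1)\<^sup>2 / 2 ^ Suc k) + t * ((s k r2)\<^sup>2 / 2 ^ Suc k)" for k
  proof -
    have "(s k r)\<^sup>2 + t * (1 - t) * (s k r1 - s k r2)\<^sup>2 = (1 - t) * (s k r1)\<^sup>2 + t * (s k r2)\<^sup>2"
      unfolding r by (simp add: power2_eq_square algebra_simps)
    then show ?thesis by (metis add_divide_distrib times_divide_eq_right)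
  qed
  then have "(\<Sum>k. (s k r)\<^sup>2 / 2 ^ Suc k + t * (1 - t) * ((s k r1 - s k r2)\<^sup>2 / 2 ^ Suc k))
      = (\<Sum>k. (1 - t) * ((s k r1)\<^sup>2 / 2 ^ Suc k) + t * ((s k r2)\<^sup>2 / 2 ^ Suc k))"
    by simp
  then have "sq_series s r + t * (1 - t) * (\<Sum>k. (s k r1 - s k r2)\<^sup>2 / 2 ^ Suc k)
      = (1 - t) * sq_series s r1 + t * sq_series s r2"
    unfolding sq_series_def
    by (simp only: suminf_add[symmetric] suminf_mult sm sd summable_mult)
  then show ?thesis by simp
qed

text \<open>No convexity of \<open>K\<close> is needed: extreme points are those whose image under \<open>s\<close> is not a
  proper convex combination of images of points of \<open>K\<close>.\<close>

definition extreme_via :: "(nat \<Rightarrow> real \<Rightarrow> real) \<Rightarrow> real set \<Rightarrow> real \<Rightarrow> bool" where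
  "extreme_via s K r \<longleftrightarrow> r \<in> K \<and> (\<forall>r1\<in>K. \<forall>r2\<in>K. \<forall>t. 0 < t \<longrightarrow> t < 1 \<longrightarrow>
        (\<forall>k. s k r = (1 - t) * s k r1 + t * s k r2) \<longrightarrow> (\<forall>k. s k r1 = s k r2))"

text \<open>The functional \<open>\<Lambda>\<close> is dominated by the upper envelope at \<open>r0\<close> and attains it on a strictly
  convex function.\<close>

theorem choquet_interval:
  fixes s :: "nat \<Rightarrow> real \<Rightarrow> real"
  assumes s: "\<And>k. continuous_on UNIV (s k)" "\<And>k r. s k r \<in> {0..1}"
    and K: "closed K" "K \<subseteq> {0..1}" and r0: "r0 \<in> K"
  obtains M where "real_distribution M" "\<And>k. (\<integral>r. s k r \<partial>M) = s k r0"
    "AE r in M. extreme_via s K r"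
proof -
  define A where "A = affine_combs s"
  note A_intros = affine_combs.intros[where s = s, folded A_def]
  have sB: "s k \<in> bcontfun" for k using s by (intro bcontfun_normI[where b = 1]) auto
  have AB: "h \<in> bcontfun" if "h \<in> A" for h using affine_combs_bcontfun[OF sB] that by (simp add: A_def)
  define g where "g = sq_series s"
  have g: "g \<in> bcontfun" unfolding g_def using s by (rule sq_series_bcontfun)
  define H where "H F = {h \<in> A. \<forall>r\<in>K. apply_bcontfun F r \<le> h r}" for F :: "(real, real) bcontfun"
  define p where "p F = (INF h\<in>H F. h r0)" for F
  have ne: "H F \<noteq> {}" for F
  proof -
    have "(\<lambda>_. norm F) \<in> H F"
      using norm_bounded[of F] by (auto simp: H_def A_intros intro: order_trans[OF abs_ge_self])
    then show ?thesis by blast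
  qed
  have bdd: "bdd_below ((\<lambda>h. h r0) ` H F)" for F
    using r0 by (intro bdd_belowI2[where m = "apply_bcontfun F r0"]) (auto simp: H_def)
  have low: "p F \<le> h r0" if "h \<in> H F" for h F unfolding p_def by (intro cINF_lower bdd that)
  have great: "m \<le> p F" if "\<And>h. h \<in> H F \<Longrightarrow> m \<le> h r0" for m F
    unfolding p_def using that by (intro cINF_greatest ne)
  have "sublinear p"
  proof (rule sublinearI)
    fix F F' :: "(real, real) bcontfun"
    have *: "p (F + F') \<le> h r0 + h' r0" if "h \<in> H F" "h' \<in> H F'" for h h'
      using that by (intro low[of "\<lambda>r. h r + h' r"]) (auto simp: H_def A_intros intro: add_mono)
    have "p (F + F') - h' r0 \<le> p F" if "h' \<in> H F'" for h'
      using *[OF _ that] by (intro great) (simp add: algebra_simps)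
    then have "p (F + F') - p F \<le> p F'" by (intro great) (simp add: algebra_simps)
    then show "p (F + F') \<le> p F + p F'" by simp
  next
    fix c :: real and F :: "(real, real) bcontfun" assume c: "c > 0"
    have "p (c *\<^sub>R F) / c \<le> p F"
    proof (rule great)
      fix h assume "h \<in> H F"
      then have "(\<lambda>r. c * h r) \<in> H (c *\<^sub>R F)" using c by (auto simp: H_def A_intros)
      from low[OF this] show "p (c *\<^sub>R F) / c \<le> h r0" using c by (simp add: field_simps)
    qed
    then show "p (c *\<^sub>R F) \<le> c * p F" using c by (simp add: field_simps)
  qed
  then obtain L where L: "linear L" "\<And>F. L F \<le> p F" "L (Bcontfun g) = p (Bcontfun g)"
    using hahn_banach_sublinear by blast
  define \<Lambda> where "\<Lambda> f = L (Bcontfun f)" for f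
  have app: "apply_bcontfun (Bcontfun f) = f" if "f \<in> bcontfun" for f :: "real \<Rightarrow> real"
    using that by (rule Bcontfun_inverse)
  have up: "\<Lambda> f \<le> h r0" if "f \<in> bcontfun" "h \<in> A" "\<And>r. r \<in> K \<Longrightarrow> f r \<le> h r" for f h
  proof -
    have "h \<in> H (Bcontfun f)" using that by (simp add: H_def app)
    then show ?thesis unfolding \<Lambda>_def using L(2) low by (meson order_trans)
  qed
  have madd: "\<Lambda> (\<lambda>x. f x + f' x) = \<Lambda> f + \<Lambda> f'" if "f \<in> bcontfun" "f' \<in> bcontfun" for f f'
  proof -
    have "Bcontfun (\<lambda>x. f x + f' x) = Bcontfun f + Bcontfun f'"
      using that by (intro bcontfun_eqI) (simp add: app bcontfun_add)
    then show ?thesis unfolding \<Lambda>_def using linear_add[OF L(1)] by simp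
  qed
  have mmult: "\<Lambda> (\<lambda>x. c * f x) = c * \<Lambda> f" if "f \<in> bcontfun" for f c
  proof -
    have "Bcontfun (\<lambda>x. c * f x) = c *\<^sub>R Bcontfun f"
      using that by (intro bcontfun_eqI) (simp add: app bcontfun_mult)
    then show ?thesis unfolding \<Lambda>_def using linear_cmul[OF L(1)] by simp
  qed
  \<comment> \<open>An affine function is its own majorant. Applying the bound to it and to its
    negative makes \<open>r0\<close> the barycentre.\<close>
  have \<Lambda>A: "\<Lambda> h = h r0" if h: "h \<in> A" for h
  proof (rule antisym)
    show "\<Lambda> h \<le> h r0" by (intro up AB h order_refl)
    have "\<Lambda> (\<lambda>r. (-1) * h r) \<le> (-1) * h r0"
      by (rule up[of "\<lambda>r. (-1) * h r" "\<lambda>r. (-1) * h r"]) (intro AB A_intros h order_refl)+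
    then show "h r0 \<le> \<Lambda> h" using mmult[OF AB[OF h], of "-1"] by simp
  qed
  have pos: "0 \<le> \<Lambda> f" if f: "f \<in> bcontfun" "\<And>x. x \<in> K \<Longrightarrow> 0 \<le> f x" for f
  proof -
    have "\<Lambda> (\<lambda>r. (-1) * f r) \<le> 0"
      using f by (intro up[where h = "\<lambda>_. 0"] bcontfun_mult A_intros) auto
    then show ?thesis using mmult[OF f(1), of "-1"] by simp
  qed
  have state: "state_on_interval \<Lambda>"
  proof
    show "0 \<le> \<Lambda> f" if "f \<in> bcontfun" "\<And>x. x \<in> {-1..1} \<Longrightarrow> 0 \<le> f x" for f
    proof (rule pos[OF that(1)])
      fix x assume "x \<in> K"
      then have "x \<in> {-1..1}" using K(2) by fastforce
      then show "0 \<le> f x" by (rule that(2))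
    qed
    show "\<Lambda> (\<lambda>_. 1) = 1" using \<Lambda>A[OF A_intros(1)] by simp
  qed (simp_all add: madd mmult)
  have "0 \<le> \<Lambda> f" if "f \<in> bcontfun" "\<And>x. x \<in> {0..1} \<Longrightarrow> 0 \<le> f x" for f
    using that K(2) by (intro pos) blast+
  from riesz_representation_interval[OF state this]
  obtain M where M: "real_distribution M" "\<And>f. f \<in> bcontfun \<Longrightarrow> (\<integral>r. f r \<partial>M) = \<Lambda> f" by metis
  interpret real_distribution M by fact
  have meas: "f \<in> borel_measurable M" if "f \<in> bcontfun" for f :: "real \<Rightarrow> real"
    using that by (intro measurable_finite_borel borel_measurable_continuous_onI) (simp add: bcontfun_def)
  have int: "integrable M f" if f: "f \<in> bcontfun" for f :: "real \<Rightarrow> real"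
  proof -
    obtain B where B: "\<And>r. \<bar>f r\<bar> \<le> B" using f by (auto simp: bcontfun_def bounded_iff)
    then show ?thesis using meas[OF f] by (intro integrable_const_bound[where B = B]) auto
  qed
  \<comment> \<open>The truncated distance from \<open>K\<close> has the majorant 0 on
    \<open>K\<close>, so its mean vanishes.\<close>
  have AEK: "AE r in M. r \<in> K"
  proof -
    define F where "F r = min 1 (infdist r K)" for r
    have F: "F \<in> bcontfun"
      unfolding F_def by (intro bcontfun_normI[where b = 1] continuous_intros) (auto simp: infdist_nonneg)
    have "\<Lambda> F \<le> 0" using F by (intro up[where h = "\<lambda>_. 0"] A_intros) (auto simp: F_def)
    moreover have "0 \<le> (\<integral>r. F r \<partial>M)" by (simp add: F_def infdist_nonneg)
    ultimately have "(\<integral>r. F r \<partial>M) = 0" using M(2)[OF F] by linarith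
    then have AE0: "AE r in M. F r = 0"
      by (subst (asm) integral_nonneg_eq_0_iff_AE[OF int[OF F]]) (simp_all add: F_def infdist_nonneg)
    have K_zero: "r \<in> K" if "F r = 0" for r
      using that in_closed_iff_infdist_zero[OF K(1), of r] r0 by (auto simp: F_def min_def split: if_splits)
    show ?thesis using AE0 by eventually_elim (rule K_zero)
  qed
  have "\<exists>h\<in>A. (\<forall>r\<in>K. g r \<le> h r) \<and> h r0 < \<Lambda> g + 1 / Suc n" for n
  proof -
    have "p (Bcontfun g) < \<Lambda> g + 1 / Suc n" using L(3) by (simp add: \<Lambda>_def)
    then obtain h where "h \<in> H (Bcontfun g)" "h r0 < \<Lambda> g + 1 / Suc n"
      unfolding p_def using cInf_lessD[of "(\<lambda>h. h r0) ` H (Bcontfun g)"] ne by blast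
    then show ?thesis using g by (auto simp: H_def app)
  qed
  then obtain h where h: "\<And>n. h n \<in> A" "\<And>n r. r \<in> K \<Longrightarrow> g r \<le> h n r" "\<And>n. h n r0 < \<Lambda> g + 1 / Suc n"
    by metis
  \<comment> \<open>Markov's inequality: \<open>h n - g\<close> is nonnegative on \<open>K\<close>,
    and its mean \<open>h n r0 - \<Lambda> g\<close> is at most \<open>1 / Suc n\<close> because
    \<open>L\<close> attains \<open>p\<close> at \<open>g\<close>.\<close>
  have AEh: "AE r in M. \<exists>n. h n r - g r < 1 / Suc m" for m
  proof -
    define E where "E = {r \<in> space M. \<forall>n. 1 / Suc m \<le> h n r - g r}"
    have E: "E \<in> sets M"
      unfolding E_def using meas[OF AB[OF h(1)]] meas[OF g] by measurable
    have "prob E / Suc m \<le> 1 / Suc n" for n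
    proof -
      have D: "integrable M (\<lambda>r. h n r - g r)" using int[OF AB[OF h(1)]] int[OF g] by (rule Bochner_Integration.integrable_diff)
      have "prob E / Suc m = (\<integral>r. indicator E r / Suc m \<partial>M)" using E by simp
      also have "\<dots> \<le> (\<integral>r. h n r - g r \<partial>M)"
      proof (rule integral_mono_AE)
        show "integrable M (\<lambda>r. indicator E r / Suc m :: real)"
          using E by (intro Bochner_Integration.integrable_divide integrable_real_indicator) (auto simp: emeasure_eq_measure)
        show "AE r in M. indicator E r / Suc m \<le> h n r - g r"
          using AEK by eventually_elim (use h(2) in \<open>auto simp: E_def indicator_def\<close>)
      qed (rule D)
      also have "\<dots> = h n r0 - \<Lambda> g"
        using int[OF AB[OF h(1)]] int[OF g] M(2)[OF AB[OF h(1)]] M(2)[OF g] \<Lambda>A[OF h(1)] by simp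
      also have "\<dots> \<le> 1 / Suc n" using h(3)[of n] by simp
      finally show ?thesis .
    qed
    then have "prob E / Suc m \<le> 0"
      by (intro LIMSEQ_le_const[OF LIMSEQ_Suc[OF lim_1_over_n]]) auto
    then have "prob E = 0" using measure_nonneg[of M E] by (simp add: field_simps)
    then have "E \<in> null_sets M" using E by (simp add: emeasure_eq_measure null_sets_def)
    then have "AE r in M. r \<notin> E" by (rule AE_not_in)
    then show ?thesis by eventually_elim (auto simp: E_def not_le)
  qed
  then have AEh: "AE r in M. \<forall>m. \<exists>n. h n r - g r < 1 / Suc m" by (simp add: AE_all_countable)
  show ?thesis
  proof (rule that[OF M(1)])
    show "(\<integral>r. s k r \<partial>M) = s k r0" for k using M(2)[OF sB] \<Lambda>A[OF A_intros(2)] by simp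
    show "AE r in M. extreme_via s K r"
      using AEK AEh
    proof eventually_elim
      case (elim r)
      show ?case
        unfolding extreme_via_def
      proof (intro conjI ballI allI impI)
        show "r \<in> K" by (rule elim)
        fix r1 r2 t k
        assume r12: "r1 \<in> K" "r2 \<in> K" and t: "0 < t" "t < 1"
          and r: "\<forall>k. s k r = (1 - t) * s k r1 + t * s k r2"
        define d where "d = (\<Sum>k. (s k r1 - s k r2)\<^sup>2 / 2 ^ Suc k)"
        have sd: "summable (\<lambda>k. (s k r1 - s k r2)\<^sup>2 / 2 ^ Suc k)"
        proof (rule summable_sq)
          show "s k r1 - s k r2 \<in> {-1..1}" for k using s(2)[of k r1] s(2)[of k r2] by auto
        qed
        \<comment> \<open>An affine majorant within \<open>1 / Suc m\<close> of \<open>g\<close> at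
          \<open>r\<close> bounds the convexity defect of \<open>g\<close> there, as it dominates
          \<open>g\<close> at \<open>r1\<close> and \<open>r2\<close>.\<close>
        have "t * (1 - t) * d \<le> 1 / Suc m" for m
        proof -
          obtain n where n: "h n r - g r < 1 / Suc m" using elim by blast
          have "h n r = (1 - t) * h n r1 + t * h n r2"
            by (rule affine_combs_convex[OF h(1)[of n, unfolded A_def]]) (use r in blast)
          moreover have "(1 - t) * g r1 \<le> (1 - t) * h n r1" "t * g r2 \<le> t * h n r2"
            using h(2) r12 t by (auto intro!: mult_left_mono)
          moreover have "(1 - t) * g r1 + t * g r2 - g r = t * (1 - t) * d"
            unfolding g_def d_def using s(2) r by (intro sq_series_convex) auto
          ultimately show ?thesis using n by linarith
        qed
        then have "t * (1 - t) * d \<le> 0"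
          by (intro LIMSEQ_le_const[OF LIMSEQ_Suc[OF lim_1_over_n]]) auto
        moreover have "t * (1 - t) > 0" using t by simp
        ultimately have "d \<le> 0" using mult_pos_pos not_less by blast
        moreover have "(s k r1 - s k r2)\<^sup>2 / 2 ^ Suc k \<le> d"
          using sum_le_suminf[OF sd, of "{k}"] by (simp add: d_def)
        ultimately have "(s k r1 - s k r2)\<^sup>2 / 2 ^ Suc k \<le> 0" by linarith
        then show "s k r1 = s k r2" by (simp add: divide_le_0_iff power_le_zero_eq)
      qed
    qed
  qed
qed

subsection \<open>Coordinates given by semicontinuous affine functions\<close>

text \<open>Via \<open>schoenberg\<close>, this codes the truncated common epigraph
  \<open>{(c\<^sub>k)\<^sub>k. \<exists>x\<in>X. \<forall>k. d k x \<le> c\<^sub>k \<le> 1}\<close>.\<close>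

definition epi_code :: "'a set \<Rightarrow> (nat \<Rightarrow> 'a \<Rightarrow> real) \<Rightarrow> real set" where
  "epi_code X d = {r \<in> {0..1}. \<exists>x\<in>X. \<forall>k. d k x \<le> schoenberg k r}"

text \<open>The set is the projection along the compact \<open>X\<close> of all pairs
  \<open>(r, x)\<close> with \<open>d k x \<le> schoenberg k r\<close>, and these pairs form a
  closed set by lower semicontinuity.\<close>

lemma closed_epi_code:
  fixes X :: "'a::t2_space set"
  assumes X: "compact X" and d: "\<And>k. lower_semicontinuous_on X (d k)"
  shows "closed (epi_code X d)"
proof -
  let ?Q = "{0..1::real} \<times> X"
  define f where "f k p = d k (snd p) + (- schoenberg k (fst p))" for k and p :: "real \<times> 'a"
  have Q: "compact ?Q" using X by (intro compact_Times) auto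
  have "lower_semicontinuous_on ?Q (f k)" for k
    unfolding f_def
  proof (rule lower_semicontinuous_on_add)
    show "lower_semicontinuous_on ?Q (\<lambda>p. d k (snd p))"
      unfolding lower_semicontinuous_on_def
    proof
      fix a
      obtain U where U: "open U" "{x\<in>X. a < d k x} = X \<inter> U"
        using d[of k] unfolding lower_semicontinuous_on_def openin_open by blast
      then have "a < d k x \<longleftrightarrow> x \<in> U" if "x \<in> X" for x using that by blast
      then have "{p \<in> ?Q. a < d k (snd p)} = ?Q \<inter> (UNIV \<times> U)" by auto
      then show "openin (top_of_set ?Q) {p \<in> ?Q. a < d k (snd p)}"
        using U(1) by (simp add: openin_open_Int open_Times)
    qed
    show "lower_semicontinuous_on ?Q (\<lambda>p. - schoenberg k (fst p))"
      by (intro continuous_imp_lower_semicontinuous_on continuous_intros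
          continuous_on_compose2[OF schoenberg_continuous]) auto
  qed
  then have "closed {p \<in> ?Q. f k p \<le> 0}" for k
    using Q by (intro closed_sublevel compact_imp_closed)
  then have "compact (?Q \<inter> (\<Inter>k. {p \<in> ?Q. f k p \<le> 0}))"
    by (intro compact_Int_closed Q closed_INT) auto
  then have "compact (fst ` (?Q \<inter> (\<Inter>k. {p \<in> ?Q. f k p \<le> 0})))"
    by (intro compact_continuous_image continuous_intros)
  moreover have "fst ` (?Q \<inter> (\<Inter>k. {p \<in> ?Q. f k p \<le> 0})) = epi_code X d"
  proof (intro set_eqI iffI)
    fix r assume "r \<in> epi_code X d"
    then obtain x where "r \<in> {0..1}" "x \<in> X" "\<And>k. d k x \<le> schoenberg k r" by (auto simp: epi_code_def)
    then have "(r, x) \<in> ?Q \<inter> (\<Inter>k. {p \<in> ?Q. f k p \<le> 0})" by (simp add: f_def)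
    then show "r \<in> fst ` (?Q \<inter> (\<Inter>k. {p \<in> ?Q. f k p \<le> 0}))" by (rule image_eqI[rotated]) simp
  next
    fix r assume "r \<in> fst ` (?Q \<inter> (\<Inter>k. {p \<in> ?Q. f k p \<le> 0}))"
    then obtain x where "r \<in> {0..1}" "x \<in> X" "\<And>k. d k x \<le> schoenberg k r" by (auto simp: f_def)
    then show "r \<in> epi_code X d" unfolding epi_code_def by blast
  qed
  ultimately show ?thesis using compact_imp_closed by metis
qed

text \<open>The points of \<open>X\<close> below the sequence coded by \<open>r\<close> form a
  closed extremal set \<open>F\<close>: a segment with an inner point in \<open>F\<close> lifts to
  the epigraph, and extremality of \<open>r\<close> collapses the lift. The alternative for the
  coordinates arises because a value strictly between \<open>d k e\<close> and 1 could be moved both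
  ways.\<close>

lemma epi_code_extreme_fibre:
  fixes X :: "'a::locally_convex_space set"
  assumes X: "compact X" "convex X" and d: "\<And>k. d k \<in> A_l X" "\<And>k x. x \<in> X \<Longrightarrow> d k x \<in> {0..1/2}"
    and r: "extreme_via schoenberg (epi_code X d) r"
  obtains e where "e extreme_point_of X" "\<And>k. d k e = schoenberg k r \<or> schoenberg k r = 1"
proof -
  define s where "s k = schoenberg k r" for k
  have s01: "s k \<in> {0..1}" for k unfolding s_def by (rule schoenberg_bounds)
  \<comment> \<open>Surjectivity of the curve turns extremality of the parameter \<open>r\<close>
    into extremality of the sequence \<open>s\<close> within the truncated epigraph.\<close>
  have ext: "c1 = c2"
    if c: "\<And>k. c1 k \<in> {0..1}" "\<And>k. c2 k \<in> {0..1}" and x: "x1 \<in> X" "x2 \<in> X" "\<And>k. d k x1 \<le> c1 k" "\<And>k. d k x2 \<le> c2 k"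
      and t: "0 < t" "t < 1" "\<And>k. s k = (1 - t) * c1 k + t * c2 k" for c1 c2 x1 x2 t
  proof -
    obtain r1 where r1: "r1 \<in> {0..1}" "\<And>k. schoenberg k r1 = c1 k" using schoenberg_surj[of c1] c by blast
    obtain r2 where r2: "r2 \<in> {0..1}" "\<And>k. schoenberg k r2 = c2 k" using schoenberg_surj[of c2] c by blast
    have "r1 \<in> epi_code X d" "r2 \<in> epi_code X d"
      using r1 r2 x by (auto simp: epi_code_def)
    then have "\<forall>k. schoenberg k r1 = schoenberg k r2"
      using t r unfolding extreme_via_def s_def r1(2)[symmetric] r2(2)[symmetric] by blast
    then show ?thesis by (auto simp: r1 r2)
  qed
  define F where "F = {x \<in> X. \<forall>k. d k x \<le> s k}"
  have val: "d k x = s k \<or> s k = 1" if x: "x \<in> F" for x k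
  proof (rule ccontr)
    assume "\<not> (d k x = s k \<or> s k = 1)"
    moreover have "x \<in> X" "d k x \<le> s k" "0 \<le> d k x" using x d(2)[of x k] by (auto simp: F_def)
    ultimately have lt: "d k x < s k" "s k < 1" "0 \<le> d k x" using s01[of k] by auto
    \<comment> \<open>Lowering \<open>s k\<close> by \<open>\<delta>\<close> respects the epigraph,
      raising it by \<open>\<delta>\<close> respects the truncation at 1.\<close>
    define \<delta> where "\<delta> = min (s k - d k x) (1 - s k)"
    have \<delta>: "0 < \<delta>" "\<delta> \<le> s k - d k x" "\<delta> \<le> 1 - s k" using lt by (auto simp: \<delta>_def)
    have "s(k := s k - \<delta>) = s(k := s k + \<delta>)"
    proof (rule ext[of _ _ x x "1/2"])
      show "(s(k := s k - \<delta>)) j \<in> {0..1}" "(s(k := s k + \<delta>)) j \<in> {0..1}"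
        "d j x \<le> (s(k := s k - \<delta>)) j" "d j x \<le> (s(k := s k + \<delta>)) j"
        "s j = (1 - 1/2) * (s(k := s k - \<delta>)) j + 1/2 * (s(k := s k + \<delta>)) j" for j
        using s01[of j] lt x \<delta> by (auto simp: F_def field_simps)
    qed (use \<open>x \<in> X\<close> in auto)
    then have "s k - \<delta> = s k + \<delta>" by (metis fun_upd_same)
    then show False using \<delta> by simp
  qed
  have "extremal_subset F X"
    unfolding extremal_subset_def
  proof (intro conjI ballI allI impI)
    show "F \<subseteq> X" by (auto simp: F_def)
    fix a b t assume ab: "a \<in> X" "b \<in> X" and t: "0 < t" "t < (1::real)" and x: "(1 - t) *\<^sub>R a + t *\<^sub>R b \<in> F"
    \<comment> \<open>Lift of the end points: on the coordinates where \<open>s\<close> lies on the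
      upper face they are put on that face, on the others on the graph. By \<open>val\<close> the
      weighted mean of the lifts is exactly \<open>s\<close>.\<close>
    define c where "c y k = (if s k = 1 then 1 else d k y)" for y k
    have dx: "d k ((1 - t) *\<^sub>R a + t *\<^sub>R b) = (1 - t) * d k a + t * d k b" for k
      using d(1)[of k] ab t by (simp add: A_l_def affine_fun_on_def)
    have s_eq: "s k = (1 - t) * c a k + t * c b k" for k
      using val[OF x, of k] by (auto simp: c_def dx)
    have "c a = c b"
    proof (rule ext[of _ _ a b t])
      show "c a k \<in> {0..1}" "c b k \<in> {0..1}" "d k a \<le> c a k" "d k b \<le> c b k" for k
        using d(2)[OF ab(1), of k] d(2)[OF ab(2), of k] by (auto simp: c_def)
    qed (use ab t s_eq in auto)
    then have "c a k = s k" "c b k = s k" for k using s_eq[of k] by (simp_all add: algebra_simps)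
    moreover have "d k a \<le> c a k" "d k b \<le> c b k" for k
      using d(2)[OF ab(1), of k] d(2)[OF ab(2), of k] by (auto simp: c_def)
    ultimately show "a \<in> F" "b \<in> F" using ab by (auto simp: F_def)
  qed
  moreover have "closed F"
  proof -
    have "F = X \<inter> (\<Inter>k. {x \<in> X. d k x \<le> s k})" by (auto simp: F_def)
    then show ?thesis
      using compact_imp_closed[OF X(1)] d(1) by (auto simp: A_l_def intro!: closed_Int closed_INT closed_sublevel)
  qed
  moreover have "F \<noteq> {}" using r by (auto simp: extreme_via_def epi_code_def F_def s_def)
  ultimately obtain e where "e \<in> F" "e extreme_point_of X"
    using extremal_contains_extreme_point[OF X(1)] by metis
  then show ?thesis using that val by (simp add: s_def)
qed

text \<open>A value \<open>c\<^sub>k\<close> on the artificial face \<open>c\<^sub>k = 1\<close> exceeds \<open>d k\<close> by at least \<open>1/2\<close>. The hypothesis on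
  \<open>k\<close> provides a second coordinate \<open>d j\<close> which forbids this outside sets of small measure.\<close>

lemma AE_extreme_coordinates:
  fixes X :: "'a::locally_convex_space set"
  assumes X: "compact X" "convex X" and d: "\<And>k. d k \<in> A_l X" "\<And>k x. x \<in> X \<Longrightarrow> d k x \<in> {0..1/2}"
    and x0: "x0 \<in> X"
    and T: "\<And>k \<epsilon>. k \<in> T \<Longrightarrow> \<epsilon> > 0 \<Longrightarrow> \<exists>j a b. a \<ge> 0 \<and> (\<forall>y\<in>X. 0 \<le> d k y + a * d j y - b) \<and> d k x0 + a * d j x0 - b < \<epsilon>"
  obtains M where "real_distribution M" "\<And>k. (\<integral>r. schoenberg k r \<partial>M) = d k x0"
    "AE r in M. \<exists>e. e extreme_point_of X \<and> (\<forall>k\<in>T. d k e = schoenberg k r)"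
proof -
  let ?K = "epi_code X d"
  have "d k x0 \<in> {0..1}" for k using d(2)[OF x0, of k] by auto
  then obtain r0 where r0: "r0 \<in> {0..1}" "\<And>k. schoenberg k r0 = d k x0"
    using schoenberg_surj[of "\<lambda>k. d k x0"] by blast
  have cl: "closed ?K" using closed_epi_code[OF X(1), of d] d(1) by (simp add: A_l_def)
  have r0K: "r0 \<in> ?K" using r0 x0 by (auto simp: epi_code_def)
  have K01: "?K \<subseteq> {0..1}" by (auto simp: epi_code_def)
  obtain M where M: "real_distribution M" "\<And>k. (\<integral>r. schoenberg k r \<partial>M) = schoenberg k r0"
    and AE: "AE r in M. extreme_via schoenberg ?K r"
    using choquet_interval[of schoenberg ?K r0, OF schoenberg_continuous schoenberg_bounds cl K01 r0K] by blast
  interpret real_distribution M by fact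
  have meas: "schoenberg k \<in> borel_measurable M" for k
    by (intro measurable_finite_borel borel_measurable_continuous_onI schoenberg_continuous)
  have int: "integrable M (schoenberg k)" for k
    using schoenberg_bounds[of k] meas by (intro integrable_const_bound[where B = 1]) auto
  have AE1: "AE r in M. schoenberg k r \<noteq> 1" if k: "k \<in> T" for k
  proof -
    let ?E = "{r \<in> space M. schoenberg k r = 1}"
    have E: "?E \<in> sets M" using meas by measurable
    have "prob ?E / 2 \<le> \<epsilon>" if "\<epsilon> > 0" for \<epsilon>
    proof -
      obtain j a b where a: "a \<ge> 0" and ab: "\<And>y. y \<in> X \<Longrightarrow> 0 \<le> d k y + a * d j y - b"
        and lt: "d k x0 + a * d j x0 - b < \<epsilon>"
        using T[OF k \<open>\<epsilon> > 0\<close>] by blast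
      have int_ab: "integrable M (\<lambda>r. schoenberg k r + a * schoenberg j r - b)" using int by simp
      have "prob ?E / 2 = (\<integral>r. indicator ?E r / 2 \<partial>M)" using E by simp
      also have "\<dots> \<le> (\<integral>r. schoenberg k r + a * schoenberg j r - b \<partial>M)"
      proof (rule integral_mono_AE[OF _ int_ab])
        show "integrable M (\<lambda>r. indicator ?E r / 2 :: real)"
          using E by (intro Bochner_Integration.integrable_divide integrable_real_indicator) (auto simp: emeasure_eq_measure)
        \<comment> \<open>On \<open>?E\<close> coordinate \<open>k\<close> is 1 while
          \<open>d k x \<le> 1/2\<close>, which gives the constant \<open>1/2\<close>; elsewhere the
          integrand is nonnegative.\<close>
        show "AE r in M. indicator ?E r / 2 \<le> schoenberg k r + a * schoenberg j r - b"
          using AE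
        proof eventually_elim
          case (elim r)
          then obtain x where x: "x \<in> X" "\<And>k. d k x \<le> schoenberg k r" by (auto simp: extreme_via_def epi_code_def)
          have "a * d j x \<le> a * schoenberg j r" using a x(2) by (rule mult_left_mono[rotated])
          then show ?case
            using ab[OF x(1)] x(2)[of k] d(2)[OF x(1), of k] by (auto simp: indicator_def)
        qed
      qed
      also have "\<dots> = d k x0 + a * d j x0 - b" using int M(2) r0(2) prob_space by simp
      finally show ?thesis using lt by simp
    qed
    then have "prob ?E / 2 \<le> 0" by (rule field_le_epsilon) simp
    then have "prob ?E = 0" using measure_nonneg[of M ?E] by linarith
    then have "?E \<in> null_sets M" using E by (simp add: emeasure_eq_measure null_sets_def)
    then have "AE r in M. r \<notin> ?E" by (rule AE_not_in)
    then show ?thesis by eventually_elim simp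
  qed
  have "AE r in M. \<forall>k\<in>T. schoenberg k r \<noteq> 1"
    using AE1 by (subst AE_ball_countable) auto
  with AE have "AE r in M. \<exists>e. e extreme_point_of X \<and> (\<forall>k\<in>T. d k e = schoenberg k r)"
  proof eventually_elim
    case (elim r)
    obtain e where "e extreme_point_of X" "\<And>k. d k e = schoenberg k r \<or> schoenberg k r = 1"
      using epi_code_extreme_fibre[OF X d elim(1)] by blast
    then show ?case using elim(2) by blast
  qed
  then show ?thesis using that M r0(2) by simp
qed

text \<open>The extreme point \<open>e r\<close> is chosen pointwise, without measurability of
  \<open>e\<close>. For \<open>k \<in> T\<close>, however, \<open>d k\<close> along \<open>e\<close>
  agrees with a continuous function off the null set \<open>N\<close> and is constant on
  \<open>N\<close>.\<close>

lemma extreme_coordinates_represent: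
  fixes X :: "'a::locally_convex_space set" and d :: "nat \<Rightarrow> 'a \<Rightarrow> real"
  assumes X: "compact X" "convex X" and d: "\<And>k. d k \<in> A_l X" "\<And>k x. x \<in> X \<Longrightarrow> d k x \<in> {0..1/2}"
    and x0: "x0 \<in> X"
    and T: "\<And>k \<epsilon>. k \<in> T \<Longrightarrow> \<epsilon> > 0 \<Longrightarrow> \<exists>j a b. a \<ge> 0 \<and> (\<forall>y\<in>X. 0 \<le> d k y + a * d j y - b) \<and> d k x0 + a * d j x0 - b < \<epsilon>"
  obtains M e where "prob_space M" "\<And>r. e r extreme_point_of X" "represents M e (d ` T) x0"
proof -
  obtain M where M: "real_distribution M" "\<And>k. (\<integral>r. schoenberg k r \<partial>M) = d k x0"
    and AE: "AE r in M. \<exists>e. e extreme_point_of X \<and> (\<forall>k\<in>T. d k e = schoenberg k r)"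
    using AE_extreme_coordinates[OF X d x0 T] by blast
  interpret real_distribution M by fact
  obtain N where N: "{r \<in> space M. \<not> (\<exists>e. e extreme_point_of X \<and> (\<forall>k\<in>T. d k e = schoenberg k r))} \<subseteq> N"
      "emeasure M N = 0" "N \<in> sets M"
    using AE by (rule AE_E)
  have ex: "\<exists>e. e extreme_point_of X \<and> (\<forall>k\<in>T. d k e = schoenberg k r)" if "r \<notin> N" for r
    using subsetD[OF N(1), of r] that by auto
  \<comment> \<open>This supplies the default value \<open>e0\<close> on \<open>N\<close>, so that
    \<open>e r\<close> is extreme for every \<open>r\<close>.\<close>
  have "N \<noteq> UNIV" using N(2) emeasure_space_1 by auto
  then obtain e0 where e0: "e0 extreme_point_of X" using ex by blast
  define e where "e r = (if r \<in> N then e0 else SOME e. e extreme_point_of X \<and> (\<forall>k\<in>T. d k e = schoenberg k r))" for r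
  have e: "e r extreme_point_of X \<and> (\<forall>k\<in>T. d k (e r) = schoenberg k r)" if "r \<notin> N" for r
    unfolding e_def using that someI_ex[OF ex[OF that]] by simp
  show ?thesis
  proof (rule that[OF prob_space_axioms])
    show "e r extreme_point_of X" for r using e[of r] e0 by (cases "r \<in> N") (auto simp: e_def)
    show "represents M e (d ` T) x0"
      unfolding represents_def
    proof (intro ballI, elim imageE)
      fix f k assume k: "k \<in> T" and f: "f = d k"
      have eq: "f (e r) = (if r \<in> N then f e0 else schoenberg k r)" for r
        using e[of r] k f by (simp add: e_def)
      have sm: "schoenberg k \<in> borel_measurable M"
        by (intro measurable_finite_borel borel_measurable_continuous_onI schoenberg_continuous)
      have fm: "(\<lambda>r. f (e r)) \<in> borel_measurable M"
        unfolding eq using N(3) sm by (intro measurable_If_set) auto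
      have "AE r in M. r \<notin> N" using N by (intro AE_not_in) (simp add: null_sets_def)
      then have "AE r in M. f (e r) = schoenberg k r" by eventually_elim (simp add: eq)
      then have "(\<integral>r. f (e r) \<partial>M) = f x0"
        using integral_cong_AE[OF fm sm] M(2) f by simp
      then show "(\<lambda>r. f (e r)) \<in> borel_measurable M \<and> (\<integral>r. f (e r) \<partial>M) = f x0" using fm by simp
    qed
  qed
qed

text \<open>Normalising the given functions and adding as coordinates \<open>- h\<close> for continuous affine minorants
  \<open>h \<le> f\<close> with \<open>h x0\<close> close to \<open>f x0\<close> establishes the hypothesis on \<open>T\<close>.\<close>

theorem extreme_points_represent_countable:
  fixes X :: "'a::locally_convex_space set"
  assumes X: "compact X" "convex X" and D: "countable D" "D \<subseteq> A_l X" and x0: "x0 \<in> X"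
  obtains M e where "prob_space M" "\<And>r. e r extreme_point_of X" "represents M e D x0"
proof -
  have "\<exists>B>0. \<forall>x\<in>X. \<bar>f x\<bar> \<le> B" if "f \<in> A_l X" for f
    using A_l_bounded[OF X that] unfolding bounded_pos by (auto simp: image_iff)
  then obtain B where B: "\<And>f. f \<in> A_l X \<Longrightarrow> B f > 0" "\<And>f x. f \<in> A_l X \<Longrightarrow> x \<in> X \<Longrightarrow> \<bar>f x\<bar> \<le> B f"
    by metis
  \<comment> \<open>Maps values in \<open>{- B f..B f}\<close> into \<open>{0..1/2}\<close>, at
    distance at least \<open>1/2\<close> from the upper face.\<close>
  define sc where "sc f x = 1 / (4 * B f) * f x + 1/4" for f and x :: 'a
  have sc: "sc f \<in> A_l X" if "f \<in> A_l X" for f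
    unfolding sc_def[abs_def] using that B(1)[OF that] by (intro A_l_scale) auto
  have sc_range: "sc f x \<in> {0..1/2}" if "f \<in> A_l X" "x \<in> X" for f x
    using B(1)[OF that(1)] B(2)[OF that] by (auto simp: sc_def field_simps abs_le_iff)
  \<comment> \<open>The zero function keeps the family nonempty, so that a sequence can enumerate it
    even for empty \<open>D\<close>.\<close>
  define D' where "D' = insert (\<lambda>_. 0) D"
  have D': "D' \<subseteq> A_l X" using D(2) A_l_const by (auto simp: D'_def)
  have "\<exists>h. (\<lambda>x. - h x) \<in> A_l X \<and> h x0 = f x0 - 1 / Suc n \<and> (\<forall>x\<in>X. h x \<le> f x)" if fA: "f \<in> A_l X" for f and n :: nat
  proof -
    obtain h where h: "affine_fun_on X h" "continuous_on X h" "h x0 = f x0 - 1 / Suc n" "\<And>x. x \<in> X \<Longrightarrow> h x \<le> f x"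
      using A_l_continuous_minorant[OF X(2) fA x0, of "f x0 - 1 / Suc n"] by auto
    have "(\<lambda>x. - h x) \<in> A_l X"
      using affine_fun_on_lincomb[OF h(1,1), of "-1" 0 0] h(2) by (intro A_l_continuous continuous_intros) simp_all
    then show ?thesis using h by blast
  qed
  then obtain h where h: "\<And>f n. f \<in> A_l X \<Longrightarrow> (\<lambda>x. - h f n x) \<in> A_l X"
      "\<And>f n. f \<in> A_l X \<Longrightarrow> h f n x0 = f x0 - 1 / Suc n"
      "\<And>f n x. f \<in> A_l X \<Longrightarrow> x \<in> X \<Longrightarrow> h f n x \<le> f x"
    by metis
  define E where "E = D' \<union> (\<lambda>(f, n) x. - h f n x) ` (D' \<times> UNIV)"
  have E: "E \<subseteq> A_l X" using D' h(1) by (auto simp: E_def)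
  have "countable (sc ` E)" "sc ` E \<noteq> {}" using D(1) by (auto simp: E_def D'_def)
  then obtain d :: "nat \<Rightarrow> 'a \<Rightarrow> real" where d: "range d = sc ` E" using uncountable_def by metis
  have d1: "d k \<in> A_l X" for k using d sc E by (metis (no_types, lifting) imageE rangeI subsetD)
  have d2: "d k x \<in> {0..1/2}" if "x \<in> X" for k x using d sc_range[OF _ that] E by (metis (no_types, lifting) imageE rangeI subsetD)
  have T: "\<exists>j a b. a \<ge> 0 \<and> (\<forall>y\<in>X. 0 \<le> d k y + a * d j y - b) \<and> d k x0 + a * d j x0 - b < \<epsilon>"
    if k: "k \<in> d -` (sc ` D')" and \<epsilon>: "\<epsilon> > 0" for k \<epsilon>
  proof -
    obtain f where f: "f \<in> D'" "d k = sc f" using k by auto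
    then have fA: "f \<in> A_l X" using D' by auto
    obtain n where n: "inverse (real (Suc n)) < 4 * B f * \<epsilon>"
      using reals_Archimedean[of "4 * B f * \<epsilon>"] B(1)[OF fA] \<epsilon> by auto
    define g where "g = (\<lambda>x. - h f n x)"
    have "g \<in> E" using f(1) by (auto simp: E_def g_def)
    then obtain j where j: "d j = sc g" using d by (metis imageI rangeE)
    have Bg: "B g > 0" using h(1)[OF fA] by (intro B(1)) (simp add: g_def)
    \<comment> \<open>\<open>f\<close> and \<open>g\<close> are normalised by different factors;
      this weight puts both on the scale \<open>1 / (4 * B f)\<close>, and
      \<open>b = 1/4 + a/4\<close> removes the two additive constants.\<close>
    define a where "a = B g / B f"
    have eq: "d k y + a * d j y - (1/4 + a/4) = (f y - h f n y) / (4 * B f)" for y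
      using Bg B(1)[OF fA] by (simp add: f(2) j sc_def g_def a_def field_simps)
    have "0 \<le> d k y + a * d j y - (1/4 + a/4)" if "y \<in> X" for y
      unfolding eq using h(3)[OF fA that] B(1)[OF fA] by simp
    moreover have "d k x0 + a * d j x0 - (1/4 + a/4) < \<epsilon>"
      unfolding eq h(2)[OF fA] using n B(1)[OF fA]
      by (simp add: pos_divide_less_eq inverse_eq_divide mult.commute mult.left_commute)
    moreover have "a \<ge> 0" using Bg B(1)[OF fA] by (simp add: a_def)
    ultimately show ?thesis by blast
  qed
  obtain M e where M: "prob_space M" "\<And>r. e r extreme_point_of X"
      and rep: "represents M e (d ` (d -` (sc ` D'))) x0"
    using extreme_coordinates_represent[OF X d1 d2 x0 T] by blast
  interpret prob_space M by fact
  have "represents M e D x0"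
    unfolding represents_def
  proof
    fix f assume f: "f \<in> D"
    then have fA: "f \<in> A_l X" and Bf: "B f > 0" using D(2) B(1) by auto
    have "sc f \<in> range d" using d f by (auto simp: E_def D'_def)
    then have "sc f \<in> d ` (d -` (sc ` D'))" using f by (auto simp: D'_def)
    then have *: "(\<lambda>r. sc f (e r)) \<in> borel_measurable M" "(\<integral>r. sc f (e r) \<partial>M) = sc f x0"
      using rep by (auto simp: represents_def)
    have f_eq: "f x = 4 * B f * (sc f x - 1/4)" for x using Bf by (simp add: sc_def)
    have "e r \<in> X" for r using M(2)[of r] by (simp add: extreme_point_of_def)
    then have "norm (sc f (e r)) \<le> 1/2" for r using sc_range[OF fA, of "e r"] by simp
    then have int: "integrable M (\<lambda>r. sc f (e r))" using *(1) by (intro integrable_const_bound[where B = "1/2"]) auto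
    have "(\<integral>r. f (e r) \<partial>M) = (\<integral>r. 4 * B f * (sc f (e r) - 1/4) \<partial>M)" by (simp only: f_eq)
    also have "\<dots> = 4 * B f * ((\<integral>r. sc f (e r) \<partial>M) - 1/4)"
      using Bochner_Integration.integral_diff[OF int integrable_const[of "1/4"]] prob_space by simp
    also have "\<dots> = f x0" by (simp only: *(2) f_eq)
    finally have "(\<integral>r. f (e r) \<partial>M) = f x0" .
    moreover have "(\<lambda>r. f (e r)) \<in> borel_measurable M" 
      by (subst f_eq) (intro borel_measurable_times borel_measurable_diff borel_measurable_const *(1))
    ultimately show "(\<lambda>r. f (e r)) \<in> borel_measurable M \<and> (\<integral>r. f (e r) \<partial>M) = f x0" by simp
  qed
  then show ?thesis using that M by blast
qed

text \<open>The bounds for \<open>u\<close> along \<open>e\<close> are integrated against a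
  probability measure for which \<open>u\<close> has mean \<open>u x\<close>. Boundedness of
  \<open>u\<close> makes \<open>Inf\<close> and \<open>Sup\<close> genuine bounds.\<close>

theorem determined_by_extreme_points_sigma_A_s:
  fixes X :: "'a::locally_convex_space set"
  assumes X: "compact X" "convex X"
  shows "determined_by_extreme_points X (sigma_closure X (A_s X))"
  unfolding determined_by_extreme_points_def
proof (intro ballI)
  fix u x assume u: "u \<in> sigma_closure X (A_s X)" and x: "x \<in> X"
  let ?S = "u ` {e. e extreme_point_of X}"
  from sigma_closure_A_s_represents[OF X u] obtain D where D: "countable D" "D \<subseteq> A_l X"
    and rep: "\<And>M e x. prob_space M \<Longrightarrow> range e \<subseteq> X \<Longrightarrow> x \<in> X \<Longrightarrow> represents M e D x \<Longrightarrow> represents M e {u} x"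
    by metis
  obtain M e where M: "prob_space M" and e: "\<And>r. e r extreme_point_of X" and "represents M e D x"
    using extreme_points_represent_countable[OF X D x] by blast
  moreover have "range e \<subseteq> X" using e by (auto simp: extreme_point_of_def)
  ultimately have "represents M e {u} x" using rep x by blast
  then have um: "(\<lambda>r. u (e r)) \<in> borel_measurable M" and ux: "(\<integral>r. u (e r) \<partial>M) = u x"
    by (auto simp: represents_def)
  interpret prob_space M by fact
  obtain C where C: "\<And>y. y \<in> X \<Longrightarrow> \<bar>u y\<bar> \<le> C"
    using sigma_closure_bounded[OF A_s_bounded[OF X] u] by (auto simp: bounded_iff)
  have "norm (u (e r)) \<le> C" for r using C[of "e r"] \<open>range e \<subseteq> X\<close> by auto
  then have int: "integrable M (\<lambda>r. u (e r))"
    by (intro integrable_const_bound[where B = C] um) auto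
  have "bounded ?S" using C by (intro boundedI[of _ C]) (auto simp: extreme_point_of_def)
  then have bdd: "bdd_below ?S" "bdd_above ?S" by (auto intro: bounded_imp_bdd_below bounded_imp_bdd_above)
  have S: "Inf ?S \<le> u (e r)" "u (e r) \<le> Sup ?S" for r
    using e bdd by (auto intro!: cInf_lower cSup_upper)
  have "(\<integral>r. Inf ?S \<partial>M) \<le> u x"
    unfolding ux[symmetric] by (rule integral_mono[OF integrable_const int S(1)])
  moreover have "u x \<le> (\<integral>r. Sup ?S \<partial>M)"
    unfolding ux[symmetric] by (rule integral_mono[OF int integrable_const S(2)])
  ultimately show "Inf ?S \<le> u x \<and> u x \<le> Sup ?S" using prob_space by simp
qed

theorem theorem7p3:
  fixes X :: "'a::locally_convex_space set"
  assumes "compact X" and "convex X"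
  shows "intermediate_function_space X (sigma_closure X (A_s X)) \<and>
         determined_by_extreme_points X (sigma_closure X (A_s X))"
  using intermediate_function_space_sigma_A_s determined_by_extreme_points_sigma_A_s assms by blast

end
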